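(* Let $p$ be a prime number, let $\chi_1$ be the principal Dirichlet character modulo $p$, and let $\alpha,\beta>0$ satisfy $\alpha\beta=\pi^2/p^2$. Define $a_n=1$ if $\gcd(n,p)=1$ and $a_n=1-p$ if $p\mid n$. Then for every integer $k\neq 0$, \begin{align*} &(4\alpha)^{-k}\left(\frac{p-1}{2}L(2k+1,\chi_1)-\sum_{n=1}^{\infty}a_n\Big(\sum_{d\mid n}\frac{\chi_1(d)}{d^{2k+1}}\Big)e^{-2n\alpha}\right)\\ &\quad-(-4\beta)^{-k}\left(\frac{p-1}{2}L(2k+1,\chi_1)-\sum_{n=1}^{\infty}a_n\Big(\sum_{d\mid n}\frac{\chi_1(d)}{d^{2k+1}}\Big)e^{-2n\beta}\right)\\ &=\sum_{j=1}^{k}(-1)^{j-1}(p^{2j}-1)(p^{2k+2-2j}-1)\frac{B_{2j}}{(2j)!}\frac{B_{2k+2-2j}}{(2k+2-2j)!}\alpha^{k+1-j}\beta^{j}, \end{align*} where for $k<0$ the finite sum on the right-hand side is empty (equal to $0$).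
   Context: $L(s,\chi)$ denotes the Dirichlet $L$-function (meromorphically continued), and $B_m$ denotes the $m$-th Bernoulli number. *)

theory Defs
  imports "HOL-Complex_Analysis.Complex_Analysis"
begin

definition principal_dchar :: "nat \<Rightarrow> nat \<Rightarrow> complex" where
  "principal_dchar m = (\<lambda>n. if coprime n m then 1 else 0)"

text \<open>
  The meromorphic continuation to the whole plane of the Dirichlet series of a character
  \<open>\<psi>\<close>. The condition \<^const>\<open>nicely_meromorphic_on\<close> removes all removable singularities
  (and fixes the value 0 at poles), so the continuation is unique as a function.
  The sum is indexed from 0, hence the shift by \<^const>\<open>Suc\<close>.
\<close>

definition is_dirichlet_L :: "(nat \<Rightarrow> complex) \<Rightarrow> (complex \<Rightarrow> complex) \<Rightarrow> bool" where
  "is_dirichlet_L \<psi> f \<longleftrightarrow>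
     f nicely_meromorphic_on UNIV \<and>
     (\<forall>s. Re s > 1 \<longrightarrow> (\<lambda>n. \<psi> (Suc n) / of_nat (Suc n) powr s) sums f s)"

definition dirichlet_L :: "complex \<Rightarrow> (nat \<Rightarrow> complex) \<Rightarrow> complex" where
  "dirichlet_L s \<psi> = (THE f. is_dirichlet_L \<psi> f) s"

lemma is_dirichlet_L_unique:
  assumes "is_dirichlet_L \<psi> f" "is_dirichlet_L \<psi> g"
  shows "f = g"
proof -
  have f: "f nicely_meromorphic_on UNIV" and g: "g nicely_meromorphic_on UNIV"
    using assms by (auto simp: is_dirichlet_L_def)
  have eq: "f s = g s" if "Re s > 1" for s
    using assms that sums_unique2 unfolding is_dirichlet_L_def by blast
  define h where "h = remove_sings (\<lambda>z. f z - g z)"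
  have mero: "(\<lambda>z. f z - g z) meromorphic_on UNIV"
    using f g by (auto simp: nicely_meromorphic_on_def intro!: meromorphic_intros)
  have h: "h nicely_meromorphic_on UNIV"
    unfolding h_def by (rule remove_sings_nicely_meromorphic[OF mero])
  have near: "eventually (\<lambda>w. h w = f w - g w) (at z)" for z
    unfolding h_def
    by (rule eventually_remove_sings_eq_at)
       (use mero in \<open>auto intro: meromorphic_on_isolated_singularity meromorphic_on_subset\<close>)
  have "\<forall>\<^sub>F s in at 2. s \<in> {s. Re s > 1}"
    by (rule eventually_at_in_open') (auto simp: open_halfspace_Re_gt)
  with near[of 2] have "\<forall>\<^sub>F s in at 2. h s = 0"
    by eventually_elim (auto simp: eq)
  then have "\<exists>\<^sub>F s in at 2. h s = 0"
    by (intro eventually_frequently) auto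
  then have "h w = 0" for w
    using h by (rule frequently_eq_meromorphic_imp_constant) auto
  with near have near': "\<forall>\<^sub>F w in at z. f w = g w" for z
    by simp
  show ?thesis
  proof
    fix z
    have pole: "is_pole f z \<longleftrightarrow> is_pole g z"
      by (rule is_pole_cong[OF near' refl])
    show "f z = g z"
    proof (cases "is_pole f z")
      case True
      then have "\<not> f \<midarrow>z\<rightarrow> f z" "\<not> g \<midarrow>z\<rightarrow> g z"
        using pole not_tendsto_and_filterlim_at_infinity at_neq_bot
        unfolding is_pole_def by blast+
      then have "f z = 0" "g z = 0"
        using f g unfolding nicely_meromorphic_on_def by blast+
      then show ?thesis
        by simp
    next
      case False
      then have "f \<midarrow>z\<rightarrow> f z" "g \<midarrow>z\<rightarrow> g z"
        using f g pole by (auto simp: nicely_meromorphic_on_def)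
      then show ?thesis
        using near' tendsto_cong tendsto_unique at_neq_bot by metis
    qed
  qed
qed

lemma dirichlet_L_eqI:
  assumes "is_dirichlet_L \<psi> f"
  shows "dirichlet_L s \<psi> = f s"
  using assms is_dirichlet_L_unique unfolding dirichlet_L_def by (metis the_equality)

text \<open>The generating function \<open>t / (e\<^sup>t - 1) = (\<Sum>n. B\<^sub>n t\<^sup>n / n!)\<close>.\<close>

definition bernoulli :: "nat \<Rightarrow> real" where
  "bernoulli n = fact n * fps_nth (fps_X / (fps_exp 1 - 1)) n"

lemma bernoulli_generating_function:
  "(fps_exp 1 - 1) * Abs_fps (\<lambda>n. bernoulli n / fact n) = fps_X"
proof -
  have "fps_nth (fps_exp 1 - 1 :: real fps) 1 \<noteq> 0" "fps_nth (fps_exp 1 - 1 :: real fps) 0 = 0"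
    by simp_all
  then have "subdegree (fps_exp 1 - 1 :: real fps) = 1"
    by (intro subdegreeI) auto
  then have "(fps_exp 1 - 1 :: real fps) dvd fps_X"
    by (subst fps_dvd_iff) auto
  moreover have "Abs_fps (\<lambda>n. bernoulli n / fact n) = fps_X / (fps_exp 1 - 1)"
    by (simp add: fps_eq_iff bernoulli_def)
  ultimately show ?thesis
    by simp
qed

end

theory Submission
  imports Defs
begin

text \<open>
  Let \<open>A x = \<Sum>m\<ge>1. a\<^sub>m e\<^sup>-\<^sup>m\<^sup>x\<close>, so that the sums in question are \<open>\<Sum> d\<^sup>-\<^sup>2\<^sup>k\<^sup>-\<^sup>1 A (2 d \<alpha>)\<close> over the \<open>d\<close>
  prime to \<open>p\<close>. The partial fraction expansion of the cotangent shows
  that \<open>(p - 1)/2 - A (2 d \<alpha>)\<close> is the sum of \<open>d / (d\<^sup>2 \<alpha> + n\<^sup>2 \<beta>)\<close> over the \<open>n\<close> prime to \<open>p\<close>.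

  For \<open>k > 0\<close> each bracket is therefore an absolutely convergent double series over \<open>(d, n)\<close>. After
  exchanging the roles of \<open>d\<close> and \<open>n\<close> in the second one, the difference of the terms is a finite geometric
  sum, and each of its members splits into a product of two values \<open>L(2j, \<chi>\<^sub>1) L(2k + 2 - 2j, \<chi>\<^sub>1)\<close>.

  For \<open>k = - m < 0\<close>, differentiating the partial fraction expansion (Lipschitz' formula) turns the sum
  over \<open>d\<close> into a sum of \<open>a\<^sub>n (l \<surd>\<alpha> \<plusminus> \<i> n \<surd>\<beta>)\<^sup>-\<^sup>2\<^sup>m\<close>, because the finite Fourier transform of \<open>\<chi>\<^sub>1\<close> is \<open>-a\<close>.
  The identity then amounts to exchanging the order of summation
  in the Eisenstein-type series \<open>\<Sum>\<^sub>l \<Sum>\<^sub>n a\<^sub>l a\<^sub>n (l \<surd>\<alpha> \<plusminus> \<i> n \<surd>\<beta>)\<^sup>-\<^sup>2\<^sup>m\<close>. This is not absolutely convergent for \<open>m = 1\<close>, but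
  \<open>a\<close> has mean zero over a period, so grouping \<open>n\<close> into blocks of length \<open>p\<close> gains a factor \<open>1/n\<close>. The
  boundary terms match \<open>L(1 - 2m, \<chi>\<^sub>1)\<close>, whose value comes from continuing \<open>\<zeta>\<close> by means of the telescoping sum
  of \<open>(n + 1)\<^sup>1\<^sup>-\<^sup>s - n\<^sup>1\<^sup>-\<^sup>s\<close> and the binomial series.
\<close>


section \<open>Partial fractions and the Lipschitz formula\<close>

lemma higher_deriv_sum:
  assumes "open S" "z \<in> S" "\<And>i. i \<in> I \<Longrightarrow> f i holomorphic_on S"
  shows "(deriv ^^ k) (\<lambda>w. \<Sum>i\<in>I. f i w) z = (\<Sum>i\<in>I. (deriv ^^ k) (f i) z)"
  using assms(3)
proof (induction I rule: infinite_finite_induct)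
  case (insert i I)
  have "(deriv ^^ k) (\<lambda>w. f i w + (\<Sum>i\<in>I. f i w)) z
          = (deriv ^^ k) (f i) z + (deriv ^^ k) (\<lambda>w. \<Sum>i\<in>I. f i w) z"
    by (rule higher_deriv_add[where S = S]) (use assms insert.prems in \<open>auto intro!: holomorphic_intros\<close>)
  then show ?case
    using insert by simp
qed auto

text \<open>Weierstrass: the M-test gives uniform convergence on \<open>S\<close>, under which
  holomorphy and all derivatives pass to the limit. The majorant is asked for only from
  \<open>N\<close> on, since the first few partial fractions may have poles too close for a uniform
  bound.\<close>

lemma higher_deriv_series:
  fixes f :: "nat \<Rightarrow> complex \<Rightarrow> complex"
  assumes "open S" "z \<in> S" "\<And>n. f n holomorphic_on S"
    and "\<And>n w. n \<ge> N \<Longrightarrow> w \<in> S \<Longrightarrow> norm (f n w) \<le> M n" "summable M"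
  shows "(\<lambda>n. (deriv ^^ k) (f n) z) sums (deriv ^^ k) (\<lambda>w. \<Sum>n. f n w) z"
    and "(\<lambda>w. \<Sum>n. f n w) holomorphic_on S"
proof -
  have ul: "uniform_limit S (\<lambda>n w. \<Sum>i<n. f i w) (\<lambda>w. \<Sum>n. f n w) sequentially"
    by (rule Weierstrass_m_test_ev[where M = M])
       (use assms in \<open>auto simp: eventually_sequentially\<close>)
  have "(\<lambda>n. (deriv ^^ k) (\<lambda>w. \<Sum>i<n. f i w) z) \<longlonglongrightarrow> (deriv ^^ k) (\<lambda>w. \<Sum>n. f n w) z"
    by (rule higher_deriv_complex_uniform_limit[OF ul])
       (use assms in \<open>auto intro!: always_eventually holomorphic_intros\<close>)
  also have "(\<lambda>n. (deriv ^^ k) (\<lambda>w. \<Sum>i<n. f i w) z) = (\<lambda>n. \<Sum>i<n. (deriv ^^ k) (f i) z)"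
    using assms by (intro ext higher_deriv_sum[where S = S]) auto
  finally show "(\<lambda>n. (deriv ^^ k) (f n) z) sums (deriv ^^ k) (\<lambda>w. \<Sum>n. f n w) z"
    by (simp add: sums_def)
  show "(\<lambda>w. \<Sum>n. f n w) holomorphic_on S"
  proof (rule holomorphic_uniform_sequence)
    show "open S" by fact
    show "(\<lambda>w. \<Sum>i<n. f i w) holomorphic_on S" for n
      using assms by (intro holomorphic_intros) auto
    show "\<exists>d>0. cball x d \<subseteq> S \<and> uniform_limit (cball x d) (\<lambda>n w. \<Sum>i<n. f i w) (\<lambda>w. \<Sum>n. f n w) sequentially"
      if x: "x \<in> S" for x
      using uniform_limit_on_subset[OF ul] assms(1) x by (meson open_contains_cball)
  qed
qed

lemma higher_deriv_exp_cmult: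
  "(deriv ^^ k) (\<lambda>w. exp (c * w)) = (\<lambda>w. c ^ k * exp (c * w :: complex))"
proof (induction k)
  case (Suc k)
  have "deriv (\<lambda>w. c ^ k * exp (c * w)) z = c ^ Suc k * exp (c * z)" for z
    by (rule DERIV_imp_deriv) (auto intro!: derivative_eq_intros)
  then show ?case
    using Suc by auto
qed simp

lemma higher_deriv_inverse_shift:
  fixes c z :: complex
  assumes "z + c \<noteq> 0"
  shows "(deriv ^^ k) (\<lambda>w. 1 / (w + c)) z = (-1) ^ k * fact k / (z + c) ^ Suc k"
  using assms
proof (induction k arbitrary: z)
  case (Suc k)
  have "open {w. w + c \<noteq> 0}"
    by (intro open_Collect_neq continuous_intros)
  then have "\<forall>\<^sub>F w in nhds z. w + c \<noteq> 0"
    using Suc.prems by (auto simp: eventually_nhds)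
  then have "\<forall>\<^sub>F w in nhds z. (deriv ^^ k) (\<lambda>w. 1 / (w + c)) w = (-1) ^ k * fact k * inverse ((w + c) ^ Suc k)"
    by eventually_elim (use Suc.IH in \<open>simp add: field_simps\<close>)
  then have "deriv ((deriv ^^ k) (\<lambda>w. 1 / (w + c))) z = deriv (\<lambda>w. (-1) ^ k * fact k * inverse ((w + c) ^ Suc k)) z"
    by (rule deriv_cong_ev) simp
  also have "\<dots> = (-1) ^ Suc k * fact (Suc k) / (z + c) ^ Suc (Suc k)"
  proof -
    define X where "X = z + c"
    have X: "X \<noteq> 0" using Suc.prems by (simp add: X_def)
    have "((\<lambda>w. (w + c) ^ Suc k) has_field_derivative of_nat (Suc k) * X ^ k) (at z)"
      using DERIV_power[OF DERIV_add[OF DERIV_ident DERIV_const], where n = "Suc k"] by (simp add: X_def)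
    then have "((\<lambda>w. (-1) ^ k * fact k * inverse ((w + c) ^ Suc k)) has_field_derivative
        (-1) ^ k * fact k * - (of_nat (Suc k) * X ^ k * inverse ((X ^ Suc k) ^ Suc (Suc 0)))) (at z)"
      using X by (intro DERIV_cmult) (use DERIV_inverse_fun[of "\<lambda>w. (w + c) ^ Suc k" _ z UNIV] in \<open>auto simp: X_def\<close>)
    also have "(-1) ^ k * fact k * - (of_nat (Suc k) * X ^ k * inverse ((X ^ Suc k) ^ Suc (Suc 0)))
                 = (-1) ^ Suc k * fact (Suc k) / X ^ Suc (Suc k)"
      using X by (simp add: field_simps)
    finally show ?thesis
      unfolding X_def by (rule DERIV_imp_deriv)
  qed
  finally show ?case by simp
qed simp

text \<open>The logarithmic derivative of Euler's reflection formula for the Gamma function, with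
  both sides differentiated separately and the non-zero factor
  \<open>Gamma z * Gamma (1 - z)\<close> cancelled.\<close>

lemma Digamma_reflection:
  fixes z :: complex
  assumes "z \<notin> \<int>"
  shows "Digamma (1 - z) - Digamma z = of_real pi * cot (of_real pi * z)"
proof -
  have sin: "sin (of_real pi * z) \<noteq> 0"
    using assms by (auto simp: sin_eq_0 elim!: Ints_cases)
  have z: "z \<notin> \<int>\<^sub>\<le>\<^sub>0" "1 - z \<notin> \<int>\<^sub>\<le>\<^sub>0"
    using assms by (metis nonpos_Ints_Int, metis Ints_1 Ints_diff diff_diff_eq2 add_diff_cancel_left' nonpos_Ints_Int)
  have G: "Gamma z * Gamma (1 - z) \<noteq> 0"
    using z by (simp add: Gamma_eq_zero_iff)
  have 1: "((\<lambda>z. Gamma z * Gamma (1 - z)) has_field_derivative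
              Gamma z * Gamma (1 - z) * (Digamma z - Digamma (1 - z))) (at z)"
    using z by (auto intro!: derivative_eq_intros simp: algebra_simps)
  have 2: "((\<lambda>z. of_real pi / sin (of_real pi * z)) has_field_derivative
              (of_real pi / sin (of_real pi * z)) * - (of_real pi * cot (of_real pi * z))) (at z)"
    using sin by (auto intro!: derivative_eq_intros simp: cot_def field_simps)
  have "Gamma z * Gamma (1 - z) * (Digamma z - Digamma (1 - z))
          = (of_real pi / sin (of_real pi * z)) * - (of_real pi * cot (of_real pi * z))"
    using DERIV_unique[OF 1] 2 unfolding Gamma_reflection_complex by blast
  then show ?thesis
    using G unfolding Gamma_reflection_complex
    by (metis minus_diff_eq minus_equation_iff mult_left_cancel)
qed

lemma pi_cot_sums:
  fixes z :: complex
  assumes "z \<notin> \<int>"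
  shows "(\<lambda>n. 1 / (z + of_nat (Suc n)) + 1 / (z - of_nat (Suc n)))
           sums (of_real pi * cot (of_real pi * z) - 1 / z)"
proof -
  have z0: "z \<noteq> 0" "1 - z \<noteq> 0"
    using assms by auto
  have D: "(\<lambda>n. inverse (of_nat (Suc n)) - inverse (w + of_nat n)) sums (Digamma w + euler_mascheroni)"
    if "w \<noteq> 0" for w :: complex
    using summable_sums[OF summable_Digamma[OF that]] by (simp add: Digamma_def)
  have "(\<lambda>n. inverse (z + of_nat n) - inverse (1 - z + of_nat n)) sums (Digamma (1 - z) - Digamma z)"
    using sums_diff[OF D[OF z0(2)] D[OF z0(1)]] by simp
  \<comment> \<open>The difference of the Digamma series pairs \<open>1/(z + n)\<close> with
    \<open>1/(z - (n + 1))\<close>. Adding this telescoping series raises the first index by one,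
    which makes the pairs symmetric and costs the term \<open>1/z\<close>.\<close>
  moreover have "(\<lambda>n. inverse (z + of_nat (Suc n)) - inverse (z + of_nat n)) sums (0 - inverse (z + of_nat 0))"
    by (intro telescope_sums filterlim_compose[OF tendsto_inverse_0]
              tendsto_add_filterlim_at_infinity[OF tendsto_const] tendsto_of_nat)
  ultimately have "(\<lambda>n. (inverse (z + of_nat n) - inverse (1 - z + of_nat n))
                       + (inverse (z + of_nat (Suc n)) - inverse (z + of_nat n)))
        sums (Digamma (1 - z) - Digamma z + (0 - inverse (z + of_nat 0)))"
    by (rule sums_add)
  also have "(\<lambda>n. (inverse (z + of_nat n) - inverse (1 - z + of_nat n))
                       + (inverse (z + of_nat (Suc n)) - inverse (z + of_nat n)))
           = (\<lambda>n. 1 / (z + of_nat (Suc n)) + 1 / (z - of_nat (Suc n)))"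
  proof
    fix n
    have "inverse (z - of_nat (Suc n)) = - inverse (1 - z + of_nat n)"
      by (metis (no_types, opaque_lifting) inverse_minus_eq minus_diff_eq diff_add_eq of_nat_Suc)
    then show "(inverse (z + of_nat n) - inverse (1 - z + of_nat n))
                       + (inverse (z + of_nat (Suc n)) - inverse (z + of_nat n))
             = 1 / (z + of_nat (Suc n)) + 1 / (z - of_nat (Suc n))"
      by (simp only: inverse_eq_divide) simp
  qed
  finally show ?thesis
    using Digamma_reflection[OF assms] by (simp add: inverse_eq_divide)
qed

abbreviation period :: "nat \<Rightarrow> complex" where
  "period n \<equiv> 2 * of_real pi * \<i> * of_nat n"

text \<open>The cotangent expansion at \<open>w = z / (2 pi i)\<close>, divided by
  \<open>2 pi i\<close>: Euler's formulas turn the cotangent into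
  \<open>i (exp z + 1) / (exp z - 1)\<close>.\<close>

lemma exp_pfd_sums:
  assumes "exp z \<noteq> 1"
  shows "(\<lambda>n. 1 / (z + period (Suc n)) + 1 / (z - period (Suc n)))
           sums (1 / (exp z - 1) + 1 / 2 - 1 / z)"
proof -
  define c :: complex where "c = 2 * of_real pi * \<i>"
  define w where "w = z / c"
  have c: "c \<noteq> 0" by (simp add: c_def)
  have zw: "z = c * w"
    using c by (simp add: w_def)
  have "w \<notin> \<int>"
  proof
    assume "w \<in> \<int>"
    then obtain n where "w = of_int n" by (elim Ints_cases)
    then have "z = of_int n * complex_of_real (2 * pi) * \<i>"
      by (simp add: zw c_def)
    then have "exp z = 1"
      using exp_eq_1 [of z] by (auto intro!: exI[of _ n])
    with assms show False by simp
  qed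
  then have "(\<lambda>n. inverse c * (1 / (w + of_nat (Suc n)) + 1 / (w - of_nat (Suc n))))
           sums (inverse c * (of_real pi * cot (of_real pi * w) - 1 / w))"
    by (intro sums_mult pi_cot_sums)
  also have "(\<lambda>n. inverse c * (1 / (w + of_nat (Suc n)) + 1 / (w - of_nat (Suc n))))
        = (\<lambda>n. 1 / (z + c * of_nat (Suc n)) + 1 / (z - c * of_nat (Suc n)))"
  proof
    fix n
    have "z + c * of_nat (Suc n) = c * (w + of_nat (Suc n))" "z - c * of_nat (Suc n) = c * (w - of_nat (Suc n))"
      by (simp_all only: zw ring_distribs)
    then show "inverse c * (1 / (w + of_nat (Suc n)) + 1 / (w - of_nat (Suc n)))
        = 1 / (z + c * of_nat (Suc n)) + 1 / (z - c * of_nat (Suc n))"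
      by (simp only: ring_distribs inverse_eq_divide times_divide_times_eq mult_1)
  qed
  also have "inverse c * (of_real pi * cot (of_real pi * w) - 1 / w)
               = 1 / (exp z - 1) + 1 / 2 - 1 / z"
  proof -
    define E where "E = exp (z / 2)"
    have E: "E * E = exp z" "exp (- (z / 2)) = inverse E" "E \<noteq> 0"
      by (simp_all add: E_def exp_minus mult_exp_exp)
    have E': "E\<^sup>2 \<noteq> 1"
      using E assms by (simp add: power2_eq_square)
    have iw: "\<i> * (of_real pi * w) = z / 2"
      by (simp add: zw c_def)
    have cot: "cot (of_real pi * w) = \<i> * (E\<^sup>2 + 1) / (E\<^sup>2 - 1)"
      using E(3) E' unfolding cot_def sin_exp_eq cos_exp_eq minus_mult_right[symmetric] mult_minus_left iw E
      by (simp add: E_def[symmetric] E(2)) (simp add: field_simps power2_eq_square)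
    have pc: "inverse c * (of_real pi * x) = x / (2 * \<i>)" for x
      by (simp add: c_def field_simps)
    have "inverse c * (of_real pi * cot (of_real pi * w)) = 1 / (exp z - 1) + 1 / 2"
      unfolding pc cot E(1)[symmetric] using E' by (simp add: field_simps power2_eq_square)
    moreover have "inverse c * (1 / w) = 1 / z"
      by (simp add: zw inverse_eq_divide)
    ultimately show ?thesis
      by (simp add: right_diff_distrib)
  qed
  finally show ?thesis
    by (simp add: c_def)
qed


lemma geometric_exp_sums:
  assumes "Re z > 0"
  shows "(\<lambda>d. exp (- of_nat (Suc d) * z)) sums (1 / (exp z - 1))"
proof -
  have "(\<lambda>d. exp (- z) * exp (- z) ^ d) sums (exp (- z) * (1 / (1 - exp (- z))))"
    using assms by (intro sums_mult geometric_sums) simp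
  moreover have "exp (- z) * exp (- z) ^ d = exp (- of_nat (Suc d) * z)" for d
    by (simp add: exp_of_nat_mult[symmetric] mult_exp_exp algebra_simps)
  moreover have "exp (- z) * (1 / (1 - exp (- z))) = 1 / (exp z - 1)"
    by (simp add: exp_minus field_simps)
  ultimately show ?thesis
    by simp
qed

text \<open>Lipschitz' formula: the \<open>j\<close>-th derivative of two expansions of
  \<open>1 / (exp z - 1)\<close>, the geometric series and the partial fractions. Positive and
  negative periods stay paired because the undifferentiated fractions are not summable one by one;
  \<open>j \<ge> 1\<close> removes the constant 1/2.\<close>

lemma lipschitz_sums:
  assumes "Re z > 0" "j \<ge> 1"
  shows "(\<lambda>n. 1 / (z + period (Suc n)) ^ Suc j + 1 / (z - period (Suc n)) ^ Suc j)
           sums ((\<Sum>d. of_nat (Suc d) ^ j * exp (- of_nat (Suc d) * z)) / fact j - 1 / z ^ Suc j)"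
proof -
  \<comment> \<open>Half the distance to the imaginary axis: the disc then lies in
    \<open>Re w > r\<close>, away from all poles, and the geometric series is dominated there by the
    powers of \<open>exp (- r)\<close>.\<close>
  define r where "r = Re z / 2"
  define R where "R = norm z + r"
  define S where "S = ball z r"
  define f where "f = (\<lambda>d w. exp (- of_nat (Suc d) * w :: complex))"
  define g where "g = (\<lambda>n w. 1 / (w + period (Suc n)) + 1 / (w - period (Suc n)))"
  have r: "r > 0" "R > 0" "open S" "z \<in> S"
    using assms by (auto simp: r_def R_def S_def add_nonneg_pos)
  have S: "Re w > r" "norm w \<le> R" if "w \<in> S" for w
  proof -
    have *: "norm (z - w) < r"
      using that by (simp add: S_def dist_norm)
    with abs_Re_le_cmod[of "z - w"] show "Re w > r"
      by (simp add: r_def)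
    show "norm w \<le> R"
      using norm_triangle_ineq3[of z w] * by (simp add: R_def)
  qed
  have nz: "w + period n \<noteq> 0" "w - period n \<noteq> 0" if "w \<in> S" for w n
    using S(1)[OF that] r(1) by (auto simp: complex_eq_iff)

  have f_le: "norm (f d w) \<le> exp (- r) ^ d" if "w \<in> S" for d w
  proof -
    have "norm (f d w) = exp (- (Re w * real (Suc d)))"
      by (simp add: f_def algebra_simps)
    also have "\<dots> \<le> exp (- (r * real d))"
    proof -
      have "r * real d \<le> Re w * real (Suc d)"
        by (rule mult_mono) (use S[OF that] r in auto)
      then show ?thesis by simp
    qed
    finally show ?thesis
      by (simp add: exp_of_nat_mult[symmetric] mult.commute)
  qed
  have f: "(\<lambda>d. (deriv ^^ j) (f d) z) sums (deriv ^^ j) (\<lambda>w. \<Sum>d. f d w) z"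
          "(\<lambda>w. \<Sum>d. f d w) holomorphic_on S"
    by (rule higher_deriv_series[where N = 0 and M = "\<lambda>d. exp (- r) ^ d" and S = S and z = z];
        use r f_le in \<open>auto simp: f_def intro!: holomorphic_intros summable_geometric\<close>)+

  \<comment> \<open>For \<open>n \<ge> R\<close> the poles are at distance at least
    \<open>pi * Suc n\<close> from every point of the disc. A pair combines to \<open>2 w\<close>
    over the product of the two distances, hence the quadratic decay.\<close>
  have g_le: "norm (g n w) \<le> 2 * R / pi\<^sup>2 * inverse (real (Suc n) ^ 2)"
    if n: "n \<ge> nat \<lceil>R\<rceil>" and w: "w \<in> S" for n w
  proof -
    have "R \<le> real (Suc n)"
      using n by linarith
    also have "\<dots> \<le> pi * real (Suc n)"
      using pi_ge_two by simp
    finally have n': "pi * real (Suc n) \<le> 2 * pi * real (Suc n) - R"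
      by simp
    have np: "norm (period (Suc n)) = 2 * pi * real (Suc n)"
      by (simp only: norm_mult norm_of_nat norm_of_real norm_ii norm_numeral) simp
    have ge: "pi * real (Suc n) \<le> norm (w + period (Suc n))" "pi * real (Suc n) \<le> norm (w - period (Suc n))"
      using norm_diff_ineq[of "period (Suc n)" w] norm_triangle_ineq2[of "period (Suc n)" w] S(2)[OF w] n'
      unfolding np by (simp_all add: add.commute norm_minus_commute)
    have "g n w = 2 * w / ((w + period (Suc n)) * (w - period (Suc n)))"
      using nz[OF w, of "Suc n"] by (simp add: g_def field_simps)
    then have "norm (g n w) = 2 * norm w / (norm (w + period (Suc n)) * norm (w - period (Suc n)))"
      by (simp add: norm_divide norm_mult)
    also have "\<dots> \<le> 2 * R / ((pi * real (Suc n)) * (pi * real (Suc n)))"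
      by (intro frac_le mult_mono mult_pos_pos) (use S(2)[OF w] ge r in auto)
    finally show ?thesis
      by (simp add: field_simps power2_eq_square)
  qed
  have g: "(\<lambda>n. (deriv ^^ j) (g n) z) sums (deriv ^^ j) (\<lambda>w. \<Sum>n. g n w) z"
  proof (rule higher_deriv_series(1)[where N = "nat \<lceil>R\<rceil>" and M = "\<lambda>n. 2 * R / pi\<^sup>2 * inverse (real (Suc n) ^ 2)" and S = S])
    show "g n holomorphic_on S" for n
      using nz[of _ "Suc n"] unfolding g_def by (intro holomorphic_intros) (auto simp del: of_nat_Suc)
    have "summable (\<lambda>n. inverse (real (Suc n) ^ 2))"
      by (subst summable_Suc_iff) (rule inverse_power_summable, simp)
    then show "summable (\<lambda>n. 2 * R / pi\<^sup>2 * inverse (real (Suc n) ^ 2))"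
      by (rule summable_mult)
  qed (use r g_le in auto)

  have f_eq: "(\<Sum>d. f d w) = 1 / (exp w - 1)" if "w \<in> S" for w
    using geometric_exp_sums[of w] S(1)[OF that] r(1) unfolding f_def by (simp add: sums_iff)
  have g_eq: "(\<Sum>n. g n w) = (\<Sum>d. f d w) + (1 / 2 - 1 / w)" if "w \<in> S" for w
  proof -
    have "norm (exp w) \<noteq> 1"
      using S(1)[OF that] r(1) by simp
    then have "exp w \<noteq> 1" by (metis norm_one)
    from exp_pfd_sums[OF this] show ?thesis
      unfolding g_def f_eq[OF that] by (simp add: sums_iff)
  qed
  have hol_inv: "(\<lambda>w. 1 / w) holomorphic_on S"
    using nz[of _ 0] by (intro holomorphic_intros) auto
  have "(deriv ^^ j) (\<lambda>w. \<Sum>n. g n w) z = (deriv ^^ j) (\<lambda>w. (\<Sum>d. f d w) + (1 / 2 - 1 / w)) z"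
    by (rule higher_deriv_transform_within_open[where S = S])
       (use r g_eq hol_inv f(2) in \<open>auto intro!: holomorphic_intros simp: g_eq cong: holomorphic_cong\<close>)
  also have "\<dots> = (deriv ^^ j) (\<lambda>w. \<Sum>d. f d w) z + (deriv ^^ j) (\<lambda>w. 1 / 2 - 1 / w) z"
    by (rule higher_deriv_add[where S = S]) (use r f(2) hol_inv in \<open>auto intro!: holomorphic_intros\<close>)
  also have "(deriv ^^ j) (\<lambda>w. 1 / 2 - 1 / w) z = (deriv ^^ j) (\<lambda>w. 1 / 2) z - (deriv ^^ j) (\<lambda>w. 1 / w) z"
    by (rule higher_deriv_diff[where S = S]) (use r hol_inv in \<open>auto intro!: holomorphic_intros\<close>)
  also have "(deriv ^^ j) (\<lambda>w. 1 / 2) z = (0 :: complex)"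
    using assms(2) by simp
  also have "(deriv ^^ j) (\<lambda>w. 1 / w) z = (-1) ^ j * fact j / z ^ Suc j"
    using higher_deriv_inverse_shift[of z 0 j] nz[OF r(4), of 0] by simp
  finally have 1: "(deriv ^^ j) (\<lambda>w. \<Sum>n. g n w) z
      = (deriv ^^ j) (\<lambda>w. \<Sum>d. f d w) z - (-1) ^ j * fact j / z ^ Suc j"
    by simp

  have "(deriv ^^ j) (f d) z = (-1) ^ j * (of_nat (Suc d) ^ j * exp (- of_nat (Suc d) * z))" for d
    unfolding f_def higher_deriv_exp_cmult
    by (subst power_minus) simp
  with f(1) have "(\<lambda>d. (-1) ^ j * ((-1) ^ j * (of_nat (Suc d) ^ j * exp (- of_nat (Suc d) * z))))
                    sums ((-1) ^ j * (deriv ^^ j) (\<lambda>w. \<Sum>d. f d w) z)"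
    by (intro sums_mult) simp
  then have 2: "(\<Sum>d. of_nat (Suc d) ^ j * exp (- of_nat (Suc d) * z)) = (-1) ^ j * (deriv ^^ j) (\<lambda>w. \<Sum>d. f d w) z"
    by (simp add: sums_iff mult.assoc[symmetric] power_add[symmetric] del: of_nat_Suc)

  have 3: "(deriv ^^ j) (g n) z = (-1) ^ j * fact j * (1 / (z + period (Suc n)) ^ Suc j + 1 / (z - period (Suc n)) ^ Suc j)" for n
  proof -
    have "(deriv ^^ j) (g n) z = (deriv ^^ j) (\<lambda>w. 1 / (w + period (Suc n))) z + (deriv ^^ j) (\<lambda>w. 1 / (w - period (Suc n))) z"
      unfolding g_def by (rule higher_deriv_add[where S = S]) (use r nz[of _ "Suc n"] in \<open>auto intro!: holomorphic_intros simp del: of_nat_Suc\<close>)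
    then show ?thesis
      using higher_deriv_inverse_shift[of z "period (Suc n)" j] higher_deriv_inverse_shift[of z "- period (Suc n)" j]
            nz[OF r(4), of "Suc n"]
      by (simp add: distrib_left del: of_nat_Suc)
  qed
  have "(\<lambda>n. (-1) ^ j / fact j * (deriv ^^ j) (g n) z) sums ((-1) ^ j / fact j * (deriv ^^ j) (\<lambda>w. \<Sum>n. g n w) z)"
    by (intro sums_mult g)
  also have "(\<lambda>n. (-1) ^ j / fact j * (deriv ^^ j) (g n) z) =
      (\<lambda>n. 1 / (z + period (Suc n)) ^ Suc j + 1 / (z - period (Suc n)) ^ Suc j)"
    unfolding 3 by (simp add: power_add[symmetric] del: of_nat_Suc power_Suc)
  also have "(-1) ^ j / fact j * (deriv ^^ j) (\<lambda>w. \<Sum>n. g n w) z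
      = (\<Sum>d. of_nat (Suc d) ^ j * exp (- of_nat (Suc d) * z)) / fact j - 1 / z ^ Suc j"
    unfolding 1 2 by (simp add: field_simps power_add[symmetric] del: of_nat_Suc power_Suc)
  finally show ?thesis .
qed

section \<open>Continuation of the zeta function\<close>

text \<open>In the shifted indexing the multiples of \<open>p\<close> occupy the positions
  \<open>p * Suc n - 1\<close>, and all other terms vanish. Later this splits the multiples of
  \<open>p\<close> off from a series.\<close>

lemma sums_dvd:
  fixes h :: "nat \<Rightarrow> 'a :: real_normed_vector"
  assumes "(\<lambda>n. h (Suc n)) sums s" "p > 0"
  shows "(\<lambda>n. if p dvd Suc n then h (Suc n div p) else 0) sums s"
proof -
  define g where "g = (\<lambda>n. p * Suc n - 1)"
  have Suc_g: "Suc (g n) = p * Suc n" for n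
    using assms(2) by (simp add: g_def)
  have "strict_mono g"
    by (rule strict_monoI) (use Suc_g assms(2) in \<open>metis Suc_less_eq mult_less_cancel1\<close>)
  moreover have "(if p dvd Suc n then h (Suc n div p) else 0) = 0" if "n \<notin> range g" for n
  proof -
    have "\<not> p dvd Suc n"
    proof
      assume "p dvd Suc n"
      then obtain k where k: "Suc n = p * k" by auto
      then obtain k' where "k = Suc k'" by (cases k) auto
      then have "n = g k'" using k Suc_g[of k'] by simp
      with that show False by auto
    qed
    then show ?thesis by simp
  qed
  ultimately show ?thesis
    using assms sums_mono_reindex[of g "\<lambda>n. if p dvd Suc n then h (Suc n div p) else 0" s]
    unfolding Suc_g by simp
qed

definition zeta_series :: "complex \<Rightarrow> complex" where
  "zeta_series s = (\<Sum>n. 1 / of_nat (Suc n) powr s)"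

lemma norm_nat_powr: "norm (of_nat (Suc n) powr s :: complex) = real (Suc n) powr Re s"
  by (subst norm_powr_real_powr) (auto simp del: of_nat_Suc)

lemma zeta_series_sums:
  assumes "Re s > 1"
  shows "(\<lambda>n. 1 / of_nat (Suc n) powr s) sums zeta_series s"
proof -
  have "summable (\<lambda>n. real (Suc n) powr - Re s)"
    by (subst summable_Suc_iff, subst summable_real_powr_iff) (use assms in simp)
  then have "summable (\<lambda>n. 1 / of_nat (Suc n) powr s)"
    by (rule summable_comparison_test')
       (simp only: norm_divide norm_nat_powr norm_one powr_minus_divide order.refl)
  then show ?thesis
    unfolding zeta_series_def by (rule summable_sums)
qed

section \<open>The binomial expansion behind the continuation\<close>

definition falling :: "nat \<Rightarrow> complex \<Rightarrow> complex" where
  "falling j w = (\<Prod>i<j. w - of_nat i)"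

lemma falling_simps [simp]: "falling 0 w = 1" "falling (Suc j) w = falling j w * (w - of_nat j)"
  by (simp_all add: falling_def)

lemma falling_of_nat: "falling j (of_nat m) = of_nat (fact j * (m choose j))"
proof -
  have "of_nat (m choose j) = falling j (of_nat m :: complex) / fact j"
    unfolding binomial_gbinomial gbinomial_prod_rev falling_def by (simp add: atLeast0LessThan)
  then show ?thesis by simp
qed

lemma holomorphic_falling [holomorphic_intros]:
  "f holomorphic_on A \<Longrightarrow> (\<lambda>s. falling j (f s)) holomorphic_on A"
  unfolding falling_def by (intro holomorphic_intros)

lemma norm_falling_le:
  assumes "norm w \<le> R"
  shows "norm (falling j w) \<le> (R + real j) ^ j"
proof -
  have "norm (falling j w) \<le> (\<Prod>i<j. R + real j)"
    unfolding falling_def prod_norm[symmetric]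
  proof (rule prod_mono)
    fix i assume "i \<in> {..<j}"
    then show "0 \<le> norm (w - of_nat i) \<and> norm (w - of_nat i) \<le> R + real j"
      using norm_triangle_ineq4[of w "of_nat i"] assms by auto
  qed
  then show ?thesis by simp
qed

text \<open>The error of the binomial series for \<open>(N + 1) powr (1 - s)\<close> around
  \<open>N = Suc n\<close>, cut off after the term of order \<open>J + 1\<close>.\<close>

definition zeta_rem :: "nat \<Rightarrow> nat \<Rightarrow> complex \<Rightarrow> complex" where
  "zeta_rem J n s = of_nat (Suc (Suc n)) powr (1 - s) -
     (\<Sum>j\<le>Suc J. falling j (1 - s) / fact j * of_nat (Suc n) powr (1 - s - of_nat j))"

text \<open>Taylor's formula for \<open>x powr (1 - s)\<close> on the segment from
  \<open>n + 1\<close> to \<open>n + 2\<close>, whose derivative of order \<open>J + 2\<close> has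
  the exponent \<open>- s - J - 1\<close>. The bound depends on \<open>s\<close> only through
  \<open>R\<close> and \<open>\<sigma>\<close>, as the M-test demands, and is summable in
  \<open>n\<close> because \<open>\<sigma> > - J\<close>.\<close>

lemma zeta_rem_bound:
  assumes s: "norm s \<le> R" "Re s \<ge> \<sigma>" and \<sigma>: "\<sigma> > - real J"
  shows "norm (zeta_rem J n s) \<le> (1 + R + real (J + 2)) ^ (J + 2) / fact (Suc J) * real (Suc n) powr (- \<sigma> - real J - 1)"
proof -
  define N where "N = real (Suc n)"
  \<comment> \<open>\<open>f i\<close> is the \<open>i\<close>-th derivative of
    \<open>x powr (1 - s)\<close> with respect to \<open>x\<close>.\<close>
  define f where "f = (\<lambda>i x. falling i (1 - s) * x powr (1 - s - of_nat i))"
  define S where "S = complex_of_real ` {N..N+1}"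
  have N: "N \<ge> 1" by (simp add: N_def)
  have "convex S"
    unfolding S_def by (intro convex_linear_image) (auto intro!: linearI simp: scaleR_conv_of_real)
  then have "norm (f 0 (of_real (N + 1)) - (\<Sum>i\<le>Suc J. f i (of_real N) * (of_real (N + 1) - of_real N) ^ i / fact i))
        \<le> ((1 + R + real (J + 2)) ^ (J + 2) * N powr (- \<sigma> - real J - 1)) * norm (of_real (N + 1) - of_real N :: complex) ^ Suc (Suc J) / fact (Suc J)"
  proof (rule complex_Taylor)
    show "(f i has_field_derivative f (Suc i) x) (at x within S)" if x: "x \<in> S" "i \<le> Suc J" for i x
    proof -
      obtain t where t: "x = of_real t" "t \<ge> 1"
        using x N by (auto simp: S_def)
      then have "x \<notin> \<real>\<^sub>\<le>\<^sub>0" by auto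
      then have "((\<lambda>x. x powr (1 - s - of_nat i)) has_field_derivative (1 - s - of_nat i) * x powr (1 - s - of_nat i - 1)) (at x)"
        by (rule has_field_derivative_powr)
      then have D: "(f i has_field_derivative falling i (1 - s) * ((1 - s - of_nat i) * x powr (1 - s - of_nat i - 1))) (at x)"
        unfolding f_def by (rule DERIV_cmult)
      have e: "1 - s - of_nat i - 1 = 1 - s - of_nat (Suc i)"
        by simp
      have "falling i (1 - s) * ((1 - s - of_nat i) * x powr (1 - s - of_nat i - 1)) = f (Suc i) x"
        unfolding f_def falling_simps mult.assoc e ..
      with D show ?thesis
        by (metis has_field_derivative_at_within)
    qed
    show "norm (f (Suc (Suc J)) x) \<le> (1 + R + real (J + 2)) ^ (J + 2) * N powr (- \<sigma> - real J - 1)" if x: "x \<in> S" for x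
    proof -
      obtain t where t: "x = of_real t" "t \<ge> N"
        using x N by (auto simp: S_def)
      have "norm (x powr (1 - s - of_nat (J + 2))) = t powr (Re (1 - s - of_nat (J + 2)))"
        using t N by (simp add: norm_powr_real_powr)
      also have "\<dots> \<le> t powr (- \<sigma> - real J - 1)"
        using t N s by (intro powr_mono) auto
      also have "\<dots> \<le> N powr (- \<sigma> - real J - 1)"
        using t N \<sigma> by (intro powr_mono2') auto
      finally have 1: "norm (x powr (1 - s - of_nat (J + 2))) \<le> N powr (- \<sigma> - real J - 1)" .
      have 2: "norm (falling (J + 2) (1 - s)) \<le> (1 + R + real (J + 2)) ^ (J + 2)"
        using norm_triangle_ineq4[of 1 s] s by (intro norm_falling_le) simp
      have "norm (f (J + 2) x) \<le> (1 + R + real (J + 2)) ^ (J + 2) * N powr (- \<sigma> - real J - 1)"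
        unfolding f_def norm_mult using order.trans[OF norm_ge_zero 2]
        by (intro mult_mono 1 2) auto
      then show ?thesis by simp
    qed
  qed (auto simp: S_def simp del: of_real_add)
  moreover have "f 0 (of_real (N + 1)) - (\<Sum>i\<le>Suc J. f i (of_real N) * (of_real (N + 1) - of_real N) ^ i / fact i) = zeta_rem J n s"
  proof -
    have "of_real (N + 1) - of_real N = (1 :: complex)" "of_real (N + 1) = (of_nat (Suc (Suc n)) :: complex)"
      "of_real N = (of_nat (Suc n) :: complex)"
      by (simp_all add: N_def)
    then show ?thesis
      unfolding f_def zeta_rem_def by (simp only: power_one mult_1_right falling_simps mult_1 of_nat_0 diff_zero times_divide_eq_left)
  qed
  ultimately show ?thesis
    by (simp add: N_def)
qed

lemma zeta_rem_summable:
  assumes "Re s > - real J"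
  shows "summable (\<lambda>n. zeta_rem J n s)"
proof -
  have "summable (\<lambda>n. (1 + norm s + real (J + 2)) ^ (J + 2) / fact (Suc J) * real (Suc n) powr (- Re s - real J - 1))"
    by (intro summable_mult, subst summable_Suc_iff, subst summable_real_powr_iff) (use assms in simp)
  then show ?thesis
    by (rule summable_comparison_test') (rule zeta_rem_bound, use assms in auto)
qed

lemma zeta_rem_holomorphic: "(\<lambda>s. \<Sum>n. zeta_rem J n s) holomorphic_on {s. Re s > - real J}"
proof -
  have "\<exists>r>0. (\<lambda>s. \<Sum>n. zeta_rem J n s) holomorphic_on ball z r" if z: "Re z > - real J" for z
  proof -
    define r where "r = (Re z + real J) / 2"
    have r: "r > 0" using z by (simp add: r_def)
    have "(\<lambda>s. \<Sum>n. zeta_rem J n s) holomorphic_on ball z r"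
    proof (rule higher_deriv_series(2)[where N = 0 and z = z])
      show "zeta_rem J n holomorphic_on ball z r" for n
        unfolding zeta_rem_def by (intro holomorphic_intros) auto
      show "norm (zeta_rem J n w) \<le> (1 + (norm z + r) + real (J + 2)) ^ (J + 2) / fact (Suc J) * real (Suc n) powr (- (Re z - r) - real J - 1)"
        if "w \<in> ball z r" for n w
      proof (rule zeta_rem_bound)
        have *: "norm (w - z) < r" using that by (simp add: dist_norm norm_minus_commute)
        show "norm w \<le> norm z + r"
          using norm_triangle_ineq2[of w z] * by simp
        show "Re z - r \<le> Re w"
          using abs_Re_le_cmod[of "w - z"] * by simp
        show "Re z - r > - real J"
          using z by (simp add: r_def field_simps)
      qed
      show "summable (\<lambda>n. (1 + (norm z + r) + real (J + 2)) ^ (J + 2) / fact (Suc J) * real (Suc n) powr (- (Re z - r) - real J - 1))"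
        by (intro summable_mult, subst summable_Suc_iff, subst summable_real_powr_iff)
           (use r in \<open>simp add: r_def field_simps\<close>)
    qed (use r in auto)
    with r show ?thesis by blast
  qed
  then show ?thesis
    unfolding holomorphic_on_def
    by (metis centre_in_ball field_differentiable_at_within mem_Collect_eq
        at_within_open open_ball)
qed

text \<open>The last factor of \<open>falling (i + 2) (1 - s)\<close> is, up to sign,
  \<open>(s + i + 1) - 1\<close>. It is left out because it belongs to the pole-free product
  \<open>(w - 1) * zeta w\<close> at \<open>w = s + i + 1\<close>.\<close>

definition zeta_coeff :: "nat \<Rightarrow> complex \<Rightarrow> complex" where
  "zeta_coeff i s = falling (Suc i) (1 - s) / fact (i + 2)"

text \<open>Sum the binomial expansion of the differences of \<open>n powr (1 - s)\<close> over
  \<open>n\<close>. The differences telescope to -1, the first-order term is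
  \<open>(1 - s) * zeta s\<close>, and the higher terms are zeta values further to the right. Solved
  for the first-order term, all that remains is defined further to the left.\<close>

lemma zeta_series_rec:
  assumes "Re s > 1"
  shows "(s - 1) * zeta_series s
     = 1 - (\<Sum>i<J. zeta_coeff i s * ((s + of_nat (Suc i) - 1) * zeta_series (s + of_nat (Suc i)))) + (\<Sum>n. zeta_rem J n s)"
proof -
  define u where "u = (\<lambda>n. of_nat (Suc n) powr (1 - s) :: complex)"
  have "(\<lambda>n. real (Suc n) powr (1 - Re s)) \<longlonglongrightarrow> 0"
    by (rule LIMSEQ_Suc, rule tendsto_neg_powr) (use assms in \<open>auto intro: filterlim_real_sequentially\<close>)
  then have "(\<lambda>n. norm (u n)) \<longlonglongrightarrow> 0"
    by (simp only: u_def norm_nat_powr) simp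
  then have "(\<lambda>n. u (Suc n) - u n) sums (0 - u 0)"
    by (intro telescope_sums) (simp add: tendsto_norm_zero_iff)
  then have tel: "(\<lambda>n. u (Suc n) - u n) sums (- 1)"
    by (simp add: u_def)

  define t where "t = (\<lambda>j n. falling j (1 - s) / fact j * of_nat (Suc n) powr (1 - s - of_nat j))"
  have t: "(\<lambda>n. t (Suc j) n) sums (falling (Suc j) (1 - s) / fact (Suc j) * zeta_series (s + of_nat j))" for j
  proof -
    have "(\<lambda>n. falling (Suc j) (1 - s) / fact (Suc j) * (1 / of_nat (Suc n) powr (s + of_nat j)))
            sums (falling (Suc j) (1 - s) / fact (Suc j) * zeta_series (s + of_nat j))"
      by (intro sums_mult zeta_series_sums) (use assms in simp)
    moreover have "1 / of_nat (Suc n) powr (s + of_nat j) = of_nat (Suc n) powr (1 - s - of_nat (Suc j))" for n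
      by (subst inverse_eq_divide[symmetric], subst powr_minus[symmetric]) (simp add: algebra_simps)
    ultimately show ?thesis
      unfolding t_def by (simp only:)
  qed
  have "(\<lambda>n. (\<Sum>j\<le>J. t (Suc j) n) + zeta_rem J n s) sums
      ((\<Sum>j\<le>J. falling (Suc j) (1 - s) / fact (Suc j) * zeta_series (s + of_nat j)) + (\<Sum>n. zeta_rem J n s))"
    by (intro sums_add sums_sum t summable_sums zeta_rem_summable) (use assms in simp)
  moreover have "(\<Sum>j\<le>J. t (Suc j) n) + zeta_rem J n s = u (Suc n) - u n" for n
    unfolding zeta_rem_def sum.atMost_Suc_shift by (simp add: t_def u_def)
  ultimately have 1: "(\<Sum>j\<le>J. falling (Suc j) (1 - s) / fact (Suc j) * zeta_series (s + of_nat j)) + (\<Sum>n. zeta_rem J n s) = - 1"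
    using tel sums_unique2 by force
  have 2: "(\<Sum>j\<le>J. falling (Suc j) (1 - s) / fact (Suc j) * zeta_series (s + of_nat j))
     = (1 - s) * zeta_series s + (\<Sum>i<J. falling (Suc (Suc i)) (1 - s) / fact (Suc (Suc i)) * zeta_series (s + of_nat (Suc i)))"
    unfolding lessThan_Suc_atMost[symmetric] sum.lessThan_Suc_shift by simp
  have 3: "falling (Suc (Suc i)) (1 - s) / fact (Suc (Suc i)) * zeta_series (s + of_nat (Suc i))
     = - (zeta_coeff i s * ((s + of_nat (Suc i) - 1) * zeta_series (s + of_nat (Suc i))))" for i
  proof -
    have "falling (Suc (Suc i)) (1 - s) = - (falling (Suc i) (1 - s) * (s + of_nat (Suc i) - 1))"
      by (subst falling_simps(2)) (simp add: algebra_simps)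
    then show ?thesis
      unfolding zeta_coeff_def by (simp del: falling_simps)
  qed
  have "(s - 1) * z = 1 - C + R" if "(1 - s) * z + - C + R = - 1" for z C R
    using that by algebra
  with 1 show ?thesis
    unfolding 2 3 sum_negf by blast
qed

section \<open>Gluing the continuations to an entire function\<close>

lemma halfplane_Re_gt: "open {s. Re s > c}" "connected {s. Re s > c}"
  by (auto intro: open_halfspace_Re_gt convex_connected convex_halfspace_Re_gt)

text \<open>Each step moves the boundary one unit to the left: for \<open>Re s > - N\<close> the
  recursion calls the previous continuation only at \<open>s + 1\<close>, ..., \<open>s + N\<close>,
  which lie in its domain.\<close>

lemma zeta_continuation_halfplane:
  "\<exists>Z. Z holomorphic_on {s. Re s > 1 - real N} \<and> (\<forall>s. Re s > 1 \<longrightarrow> Z s = (s - 1) * zeta_series s)"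
proof (induction N)
  case 0
  have "(\<lambda>s. 1 + (\<Sum>n. zeta_rem 0 n s)) holomorphic_on {s. Re s > 1 - real 0}"
    by (intro holomorphic_intros holomorphic_on_subset[OF zeta_rem_holomorphic]) auto
  then show ?case
    using zeta_series_rec[where J = 0] by (intro exI[of _ "\<lambda>s. 1 + (\<Sum>n. zeta_rem 0 n s)"]) auto
next
  case (Suc N)
  then obtain Z where Z: "Z holomorphic_on {s. Re s > 1 - real N}"
    "\<And>s. Re s > 1 \<Longrightarrow> Z s = (s - 1) * zeta_series s" by blast
  define Z' where "Z' = (\<lambda>s. 1 - (\<Sum>i<N. zeta_coeff i s * Z (s + of_nat (Suc i))) + (\<Sum>n. zeta_rem N n s))"
  have "(\<lambda>s. Z (s + of_nat (Suc i))) holomorphic_on {s. Re s > - real N}" for i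
    by (rule holomorphic_on_compose_gen[unfolded o_def, OF _ Z(1)]) (auto intro!: holomorphic_intros)
  then have "Z' holomorphic_on {s. Re s > - real N}"
    unfolding Z'_def zeta_coeff_def by (intro holomorphic_intros zeta_rem_holomorphic) auto
  moreover have "Z' s = (s - 1) * zeta_series s" if "Re s > 1" for s
    using zeta_series_rec[OF that, of N] that unfolding Z'_def by (simp add: Z(2))
  ultimately show ?case
    by (intro exI[of _ Z']) auto
qed

text \<open>Continuations to nested half-planes agree on the smaller one by the identity theorem,
  since both equal \<open>f\<close> for \<open>Re s > c\<close>. The value at \<open>s\<close> can
  therefore be read from any half-plane that contains \<open>s\<close>.\<close>

lemma entire_extension:
  fixes f :: "complex \<Rightarrow> complex"
  assumes "\<And>N. \<exists>g. g holomorphic_on {s. Re s > c - real N} \<and> (\<forall>s. Re s > c \<longrightarrow> g s = f s)"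
  obtains g where "g holomorphic_on UNIV" "\<And>s. Re s > c \<Longrightarrow> g s = f s"
proof -
  obtain G where G: "\<And>N. G N holomorphic_on {s. Re s > c - real N}" "\<And>N s. Re s > c \<Longrightarrow> G N s = f s"
    using assms by metis
  have agree: "G N s = G M s" if "N \<le> M" "Re s > c - real N" for N M s
  proof (rule analytic_continuation_open[where f = "G N" and g = "G M" and z = s
            and s = "{s. Re s > c}" and s' = "{s. Re s > c - real N}"])
    show "{s. Re s > c} \<noteq> {}"
      by (auto intro!: exI[of _ "of_real (c + 1)"])
    show "G M holomorphic_on {s. Re s > c - real N}"
      by (rule holomorphic_on_subset[OF G(1)]) (use that in auto)
  qed (use that G halfplane_Re_gt in auto)
  define g where "g = (\<lambda>s. G (nat \<lceil>c - Re s\<rceil> + 1) s)"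
  have g_eq: "g s = G N s" if "Re s > c - real N" for N s
  proof -
    have "Re s > c - real (nat \<lceil>c - Re s\<rceil> + 1)"
      by simp linarith
    with that agree show ?thesis
      unfolding g_def by (metis nat_le_linear)
  qed
  have "g field_differentiable at s" for s
  proof -
    obtain N where N: "Re s > c - real N"
      using reals_Archimedean2[of "c - Re s"] by (auto simp: algebra_simps)
    have "g holomorphic_on {s. Re s > c - real N}"
      using G(1)[of N] by (rule holomorphic_transform) (simp add: g_eq)
    then show ?thesis
      using N halfplane_Re_gt(1) by (meson holomorphic_on_imp_differentiable_at mem_Collect_eq)
  qed
  then have "g holomorphic_on UNIV"
    by (simp add: holomorphic_on_def field_differentiable_at_within)
  moreover have "g s = f s" if "Re s > c" for s
    using g_eq[of 0 s] G(2)[OF that, of 0] that by simp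
  ultimately show ?thesis
    using that by blast
qed

lemma entire_zeta_exists:
  "\<exists>Z. Z holomorphic_on UNIV \<and> (\<forall>s. Re s > 1 \<longrightarrow> Z s = (s - 1) * zeta_series s)"
  using entire_extension[OF zeta_continuation_halfplane] by metis

text \<open>This is \<open>(s - 1) * zeta s\<close>; the factor cancels the pole at 1 and allows
  work with an entire function.\<close>

definition entire_zeta :: "complex \<Rightarrow> complex" where
  "entire_zeta = (SOME Z. Z holomorphic_on UNIV \<and> (\<forall>s. Re s > 1 \<longrightarrow> Z s = (s - 1) * zeta_series s))"

lemma entire_zeta: "entire_zeta holomorphic_on UNIV"
  and entire_zeta_eq: "Re s > 1 \<Longrightarrow> entire_zeta s = (s - 1) * zeta_series s"
  using someI_ex[OF entire_zeta_exists] unfolding entire_zeta_def by blast+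

text \<open>Both sides are holomorphic for \<open>Re s > - J\<close> and agree for
  \<open>Re s > 1\<close>, so the recursion persists by analytic continuation.\<close>

lemma entire_zeta_rec:
  assumes "Re s > - real J"
  shows "entire_zeta s = 1 - (\<Sum>i<J. zeta_coeff i s * entire_zeta (s + of_nat (Suc i))) + (\<Sum>n. zeta_rem J n s)"
proof (rule analytic_continuation_open[where z = s and f = entire_zeta and
      g = "\<lambda>s. 1 - (\<Sum>i<J. zeta_coeff i s * entire_zeta (s + of_nat (Suc i))) + (\<Sum>n. zeta_rem J n s)"
      and s = "{s. Re s > 1}" and s' = "{s. Re s > - real J}"])
  show "{s. Re s > 1} \<noteq> {}"
    by (auto intro!: exI[of _ 2])
  show "entire_zeta holomorphic_on {s. Re s > - real J}"
    using entire_zeta by (rule holomorphic_on_subset) auto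
  have "(\<lambda>s. entire_zeta (s + of_nat (Suc i))) holomorphic_on {s. Re s > - real J}" for i
    by (rule holomorphic_on_compose_gen[unfolded o_def, OF _ entire_zeta]) (auto intro!: holomorphic_intros)
  then show "(\<lambda>s. 1 - (\<Sum>i<J. zeta_coeff i s * entire_zeta (s + of_nat (Suc i))) + (\<Sum>n. zeta_rem J n s))
          holomorphic_on {s. Re s > - real J}"
    unfolding zeta_coeff_def by (intro holomorphic_intros zeta_rem_holomorphic) auto
  show "entire_zeta z = 1 - (\<Sum>i<J. zeta_coeff i z * entire_zeta (z + of_nat (Suc i))) + (\<Sum>n. zeta_rem J n z)"
    if "z \<in> {s. Re s > 1}" for z
    using that zeta_series_rec[of z J] by (simp add: entire_zeta_eq)
qed (use assms halfplane_Re_gt in auto)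

text \<open>At \<open>s = 1 - m\<close> the exponent \<open>1 - s\<close> is the natural number
  \<open>m\<close>: the binomial series terminates, and the extra term of order \<open>m + 1\<close>
  has coefficient zero.\<close>

lemma zeta_rem_nonpos_int: "zeta_rem m n (1 - of_nat m) = 0"
proof -
  have "falling j (of_nat m) / fact j * of_nat (Suc n) powr (of_nat m - of_nat j) = of_nat (m choose j) * of_nat (Suc n) ^ (m - j)" for j
  proof (cases "j \<le> m")
    case True
    then have "of_nat m - of_nat j = (of_nat (m - j) :: complex)"
      by simp
    then show ?thesis
      using powr_nat'[of "of_nat (Suc n)" "m - j"] unfolding falling_of_nat by (simp del: of_nat_Suc of_nat_diff)
  qed (simp add: falling_of_nat)
  then have "zeta_rem m n (1 - of_nat m) = of_nat (Suc (Suc n)) powr of_nat m - (\<Sum>j\<le>Suc m. of_nat (m choose j) * of_nat (Suc n) ^ (m - j))"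
    unfolding zeta_rem_def by simp
  also have "of_nat (Suc (Suc n)) powr of_nat m = (of_nat (Suc (Suc n)) ^ m :: complex)"
    by (rule powr_nat') (simp del: of_nat_Suc)
  also have "of_nat (Suc (Suc n)) ^ m = (\<Sum>j\<le>m. of_nat (m choose j) * of_nat (Suc n) ^ (m - j) :: complex)"
    using binomial_ring[of 1 "of_nat (Suc n) :: complex" m] by simp
  finally show ?thesis by simp
qed

text \<open>Without a remainder, and with \<open>1 - m + (i + 1) = 1 - l\<close> for
  \<open>l = m - Suc i\<close>, the recursion divided by \<open>fact m\<close> has the same shape as
  the one for the Bernoulli numbers.\<close>

lemma entire_zeta_nonpos_int_rec:
  "(\<Sum>l\<le>m. entire_zeta (1 - of_nat l) / (fact l * fact (Suc m - l))) = 1 / fact m"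
proof -
  have "entire_zeta (1 - of_nat m)
      = 1 - (\<Sum>i<m. zeta_coeff i (1 - of_nat m) * entire_zeta (1 - of_nat m + of_nat (Suc i)))"
    using entire_zeta_rec[of m "1 - of_nat m"] by (simp add: zeta_rem_nonpos_int)
  also have "(\<Sum>i<m. zeta_coeff i (1 - of_nat m) * entire_zeta (1 - of_nat m + of_nat (Suc i)))
     = (\<Sum>i<m. fact m * entire_zeta (1 - of_nat i) / (fact i * fact (Suc m - i)))"
  proof (rule sum.reindex_bij_witness[of _ "\<lambda>i. m - Suc i" "\<lambda>i. m - Suc i"])
    fix i assume i: "i \<in> {..<m}"
    define l where "l = m - Suc i"
    have l: "i + 2 = Suc m - l" "of_nat m = (of_nat l + of_nat (Suc i) :: complex)" "Suc i \<le> m" "l = m - Suc i"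
      using i unfolding l_def by (auto simp flip: of_nat_add)
    have "falling (Suc i) (of_nat m) = fact m / fact l"
      unfolding falling_of_nat using binomial_fact[OF l(3), where 'a = complex] l(4)
      by (simp add: field_simps del: fact_Suc of_nat_Suc)
    moreover have "1 - of_nat m + of_nat (Suc i) = (1 - of_nat l :: complex)"
      using l(2) by simp
    ultimately show "fact m * entire_zeta (1 - of_nat l) / (fact l * fact (Suc m - l))
      = zeta_coeff i (1 - of_nat m) * entire_zeta (1 - of_nat m + of_nat (Suc i))"
      unfolding zeta_coeff_def l(1)[symmetric] by (simp only:) simp
  qed auto
  also have "\<dots> = fact m * (\<Sum>i<m. entire_zeta (1 - of_nat i) / (fact i * fact (Suc m - i)))"
    by (simp only: sum_distrib_left times_divide_eq_right)
  finally have *: "entire_zeta (1 - of_nat m) = 1 - fact m * (\<Sum>i<m. entire_zeta (1 - of_nat i) / (fact i * fact (Suc m - i)))" .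
  have "z / f + S = 1 / f" if "z = 1 - f * S" "f \<noteq> 0" for z f S :: complex
    using that by (simp add: field_simps)
  from this[OF * fact_nonzero]
  have "entire_zeta (1 - of_nat m) / fact m + (\<Sum>i<m. entire_zeta (1 - of_nat i) / (fact i * fact (Suc m - i))) = 1 / fact m" .
  then show ?thesis
    unfolding lessThan_Suc_atMost[symmetric] sum.lessThan_Suc by (simp add: add.commute)
qed

text \<open>The coefficient of order \<open>m + 1\<close> in the generating identity; the index
  \<open>l = m + 1\<close> drops out because \<open>exp t - 1\<close> has no constant term.\<close>

lemma bernoulli_rec:
  "(\<Sum>l\<le>m. bernoulli l / (fact l * fact (Suc m - l))) = (if m = 0 then 1 else 0)"
proof -
  have "fps_nth (fps_exp 1 - 1) (Suc m - l) = (1 / fact (Suc m - l) :: real)" if "l \<le> m" for l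
    using that by (cases "Suc m - l") (auto simp del: fact_Suc)
  then have "(\<Sum>l\<le>m. bernoulli l / fact l * fps_nth (fps_exp 1 - 1) (Suc m - l))
      = (\<Sum>l\<le>m. bernoulli l / (fact l * fact (Suc m - l)))"
    by (intro sum.cong refl) (simp only: atMost_iff times_divide_times_eq mult_1_right)
  moreover have "fps_nth (Abs_fps (\<lambda>n. bernoulli n / fact n) * (fps_exp 1 - 1)) (Suc m)
      = (\<Sum>l\<le>m. bernoulli l / fact l * fps_nth (fps_exp 1 - 1) (Suc m - l))"
    unfolding fps_mult_nth atLeast0AtMost sum.atMost_Suc by simp
  ultimately show ?thesis
    using bernoulli_generating_function by (simp add: mult.commute)
qed

text \<open>The recursion for the values of the continuation yields the Bernoulli numbers with the
  convention \<open>B\<^sub>1 = 1/2\<close> instead of \<open>B\<^sub>1 = -1/2\<close>.\<close>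

lemma entire_zeta_nonpos_int:
  "entire_zeta (1 - of_nat m) = of_real (bernoulli m) + (if m = 1 then 1 else 0)"
proof (induction m rule: less_induct)
  case (less m)
  define b :: "nat \<Rightarrow> complex" where "b = (\<lambda>l. of_real (bernoulli l) + (if l = 1 then 1 else 0))"
  have "(\<Sum>l\<le>m. b l / (fact l * fact (Suc m - l)))
      = of_real (\<Sum>l\<le>m. bernoulli l / (fact l * fact (Suc m - l))) + (\<Sum>l\<le>m. (if l = 1 then 1 / fact m else 0))"
    unfolding of_real_sum sum.distrib[symmetric] by (intro sum.cong) (auto simp: b_def add_divide_distrib)
  also have "\<dots> = 1 / fact m"
    unfolding bernoulli_rec by (cases m) auto
  finally have "(\<Sum>l\<le>m. b l / (fact l * fact (Suc m - l)))
     = (\<Sum>l\<le>m. entire_zeta (1 - of_nat l) / (fact l * fact (Suc m - l)))"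
    unfolding entire_zeta_nonpos_int_rec .
  moreover have "(\<Sum>l<m. b l / (fact l * fact (Suc m - l)))
     = (\<Sum>l<m. entire_zeta (1 - of_nat l) / (fact l * fact (Suc m - l)))"
    by (intro sum.cong) (auto simp: b_def less.IH)
  ultimately show ?case
    unfolding lessThan_Suc_atMost[symmetric] sum.lessThan_Suc by (simp add: b_def)
qed

section \<open>Zeta values at even integers\<close>

text \<open>A majorant in product form is summable over all pairs, as its row sums are multiples of
  \<open>u\<close>. This is the only criterion by which double series are shown to converge
  here.\<close>

lemma summable_on_double_comparison:
  fixes g :: "nat \<Rightarrow> nat \<Rightarrow> complex"
  assumes "\<And>m n. norm (g m n) \<le> u m * v n" "summable u" "summable v"
    and "\<And>m. u m \<ge> 0" "\<And>n. v n \<ge> 0"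
  shows "(\<lambda>(m, n). g m n) summable_on UNIV"
proof -
  have u: "(u has_sum suminf u) UNIV" and v: "(v has_sum suminf v) UNIV"
    using assms by (auto intro!: sums_nonneg_imp_has_sum summable_sums)
  have "(\<lambda>(m, n). u m * v n) summable_on UNIV \<times> UNIV"
  proof (rule summable_on_SigmaI)
    show "((\<lambda>n. case (m, n) of (m, n) \<Rightarrow> u m * v n) has_sum u m * suminf v) UNIV" for m
      using v by (auto intro: has_sum_cmult_right)
    show "(\<lambda>m. u m * suminf v) summable_on UNIV"
      using u by (auto intro: summable_on_cmult_left has_sum_imp_summable)
  qed (use assms in auto)
  then have "(\<lambda>(m, n). u m * v n) summable_on UNIV"
    by simp
  then have "(\<lambda>x. norm (case x of (m, n) \<Rightarrow> g m n)) summable_on UNIV"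
    by (intro Infinite_Sum.abs_summable_on_comparison_test'[where g = "\<lambda>(m, n). u m * v n"]) (use assms in auto)
  then show ?thesis
    by (rule Infinite_Sum.abs_summable_summable)
qed

text \<open>Fubini's theorem in terms of \<open>sums\<close>: both iterated series converge to the
  sum over the pairs. The columns follow from the rows by swapping the coordinates.\<close>

lemma summable_on_double_sums:
  fixes g :: "nat \<Rightarrow> nat \<Rightarrow> complex"
  assumes "(\<lambda>(m, n). g m n) summable_on UNIV"
  shows "summable (g m)" and "summable (\<lambda>m. g m n)"
    and "(\<lambda>m. \<Sum>n. g m n) sums infsum (\<lambda>(m, n). g m n) UNIV"
    and "(\<lambda>n. \<Sum>m. g m n) sums infsum (\<lambda>(m, n). g m n) UNIV"
proof -
  have 1: "summable (h m)" "(\<lambda>m. \<Sum>n. h m n) sums S"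
    if "((\<lambda>(m, n). h m n) has_sum S) (UNIV \<times> UNIV)" for h :: "nat \<Rightarrow> nat \<Rightarrow> complex" and m S
  proof -
    have "h m summable_on UNIV" for m
      by (rule summable_on_SigmaD1[where A = UNIV]) (use that in \<open>auto intro: has_sum_imp_summable\<close>)
    then have row: "(h m has_sum (\<Sum>n. h m n)) UNIV" for m
      by (metis has_sum_imp_sums has_sum_infsum sums_unique)
    then show "summable (h m)"
      using has_sum_imp_sums sums_summable by blast
    have "((\<lambda>m. \<Sum>n. h m n) has_sum S) UNIV"
      by (rule has_sum_SigmaD[OF that]) (use row in auto)
    then show "(\<lambda>m. \<Sum>n. h m n) sums S"
      by (rule has_sum_imp_sums)
  qed
  have g: "((\<lambda>(m, n). g m n) has_sum infsum (\<lambda>(m, n). g m n) UNIV) (UNIV \<times> UNIV)"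
    using assms by simp
  then have g': "((\<lambda>(n, m). g m n) has_sum infsum (\<lambda>(m, n). g m n) UNIV) (UNIV \<times> UNIV)"
    by (subst (asm) has_sum_swap) (simp add: case_prod_unfold)
  show "summable (g m)" "(\<lambda>m. \<Sum>n. g m n) sums infsum (\<lambda>(m, n). g m n) UNIV"
    using 1[OF g] by auto
  show "summable (\<lambda>m. g m n)" "(\<lambda>n. \<Sum>m. g m n) sums infsum (\<lambda>(m, n). g m n) UNIV"
    using 1[OF g'] by auto
qed

section \<open>Euler's formula for zeta at even integers\<close>

lemma bernoulli_fps_complex:
  "(fps_exp 1 - 1) * Abs_fps (\<lambda>n. of_real (bernoulli n / fact n)) = (fps_X :: complex fps)"
proof (rule fps_ext)
  fix n
  have *: "fps_nth (fps_exp 1 - 1 :: complex fps) i = of_real (fps_nth (fps_exp 1 - 1) i)" for i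
    by simp
  have "fps_nth ((fps_exp 1 - 1) * Abs_fps (\<lambda>n. of_real (bernoulli n / fact n)) :: complex fps) n
      = of_real (fps_nth ((fps_exp 1 - 1) * Abs_fps (\<lambda>n. bernoulli n / fact n)) n)"
    unfolding fps_mult_nth of_real_sum of_real_mult * fps_nth_Abs_fps ..
  then show "fps_nth ((fps_exp 1 - 1) * Abs_fps (\<lambda>n. of_real (bernoulli n / fact n))) n = fps_nth (fps_X :: complex fps) n"
    unfolding bernoulli_generating_function by simp
qed

definition zeta_nat :: "nat \<Rightarrow> complex" where
  "zeta_nat j = (\<Sum>n. 1 / of_nat (Suc n) ^ j)"

lemma summable_inverse_nat_power:
  assumes "j \<ge> 2"
  shows "summable (\<lambda>n. 1 / real (Suc n) ^ j)"
proof -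
  have "summable (\<lambda>n. 1 / real n ^ j)"
    using inverse_power_summable[OF assms, where 'a = real] by (simp only: inverse_eq_divide)
  then show ?thesis
    by (rule summable_Suc_iff[THEN iffD2])
qed

lemma zeta_nat_sums:
  assumes "j \<ge> 2"
  shows "(\<lambda>n. 1 / of_nat (Suc n) ^ j) sums zeta_nat j"
proof -
  have "summable (\<lambda>n. norm (1 / of_nat (Suc n) ^ j :: complex))"
    using summable_inverse_nat_power[OF assms] by (simp only: norm_divide norm_power norm_of_nat norm_one)
  then show ?thesis
    unfolding zeta_nat_def by (rule summable_sums[OF summable_norm_cancel])
qed

lemma exp_eq_1_unit_disc:
  fixes z :: complex
  assumes "exp z = 1" "norm z < 1"
  shows "z = 0"
proof -
  obtain n :: int where n: "Re z = 0" "Im z = of_int (2 * n) * pi"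
    using assms(1) unfolding exp_eq_1 by auto
  have "n = 0"
  proof (rule ccontr)
    assume "n \<noteq> 0"
    then have "1 * 1 \<le> \<bar>of_int n :: real\<bar> * (2 * pi)"
      using pi_ge_two by (intro mult_mono) auto
    also have "\<dots> = \<bar>Im z\<bar>"
      unfolding n by (simp add: abs_mult)
    finally show False
      using abs_Im_le_cmod[of z] assms(2) by simp
  qed
  then show ?thesis
    using n by (simp add: complex_eq_iff)
qed

text \<open>Each pair of partial fractions equals \<open>2 x^2 / (1 + x^2)\<close> with
  \<open>x = z / (2 pi n)\<close>. Expanding it as a geometric series and exchanging the two sums
  collects the even zeta values as Taylor coefficients.\<close>

lemma bernoulli_function_expansion:
  fixes z :: complex
  assumes "norm z < 1" "z \<noteq> 0"
  shows "(\<lambda>j. 2 * (-1) ^ j * zeta_nat (2 * Suc j) * (z / (2 * of_real pi)) ^ (2 * Suc j))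
           sums (z / (exp z - 1) + z / 2 - 1)"
proof -
  define y where "y = z / (2 * of_real pi)"
  define g where "g = (\<lambda>n j. 2 * (-1) ^ j * (y / of_nat (Suc n)) ^ (2 * Suc j))"
  have ny: "norm y \<le> 1 / 2"
  proof -
    have "norm y = norm z / (2 * pi)" by (simp add: y_def norm_divide norm_mult)
    also have "\<dots> \<le> 1 / 2"
      by (rule frac_le) (use assms(1) pi_ge_two in auto)
    finally show ?thesis .
  qed
  \<comment> \<open>Two of the \<open>2 j + 2\<close> factors supply the decay in \<open>n\<close>,
    the other \<open>2 j\<close> the geometric decay in \<open>j\<close>.\<close>
  have g_bound: "norm (g n j) \<le> (1 / real (Suc n) ^ 2) * (1 / 2) ^ j" for n j
  proof -
    have *: "norm (y / of_nat (Suc n)) \<le> 1 / real (Suc n)" "norm (y / of_nat (Suc n)) \<le> 1 / 2" "norm (y / of_nat (Suc n)) \<le> (1 / 2) / real (Suc n)"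
    proof -
      show 3: "norm (y / of_nat (Suc n)) \<le> (1 / 2) / real (Suc n)"
        unfolding norm_divide norm_of_nat by (intro divide_right_mono ny) auto
      show "norm (y / of_nat (Suc n)) \<le> 1 / 2"
        by (rule order.trans[OF 3]) (simp add: field_simps)
      show "norm (y / of_nat (Suc n)) \<le> 1 / real (Suc n)"
        by (rule order.trans[OF 3]) (simp add: field_simps)
    qed
    have e: "w ^ (2 * Suc j) = w * w * (w ^ 2) ^ j" for w :: complex
      by (simp add: power_mult power2_eq_square)
    have "norm (g n j) = 2 * (norm (y / of_nat (Suc n)) * norm (y / of_nat (Suc n)) * (norm (y / of_nat (Suc n)) ^ 2) ^ j)"
      unfolding g_def e by (simp only: norm_mult norm_power norm_numeral norm_minus_cancel norm_one power_one mult_1_right mult.assoc)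
    also have "\<dots> \<le> 2 * ((1 / 2 / real (Suc n)) * (1 / real (Suc n)) * ((1 / 2) ^ 2) ^ j)"
      by (intro mult_mono power_mono * mult_nonneg_nonneg) auto
    also have "\<dots> \<le> 2 * ((1 / 2 / real (Suc n)) * (1 / real (Suc n)) * (1 / 2) ^ j)"
      by (intro mult_left_mono power_mono mult_nonneg_nonneg) (auto simp: power2_eq_square)
    also have "2 * ((1 / 2 / N) * (1 / N) * c) = (1 / N ^ 2) * c" for N c :: real
      by (simp add: power2_eq_square)
    finally show ?thesis .
  qed
  have g: "(\<lambda>(m, n). g m n) summable_on UNIV"
    by (rule summable_on_double_comparison[OF g_bound])
       (auto intro: summable_inverse_nat_power simp del: of_nat_Suc)
  have "exp z \<noteq> 1"
    using exp_eq_1_unit_disc assms by blast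
  from exp_pfd_sums[OF this]
  have S: "(\<lambda>n. z * (1 / (z + period (Suc n)) + 1 / (z - period (Suc n)))) sums (z * (1 / (exp z - 1) + 1 / 2 - 1 / z))"
    by (rule sums_mult)
  have row: "g n sums (z * (1 / (z + period (Suc n)) + 1 / (z - period (Suc n))))" for n
  proof -
    define x where "x = y / of_nat (Suc n)"
    define N :: complex where "N = of_nat (Suc n)"
    have N: "N \<noteq> 0" unfolding N_def by (simp del: of_nat_Suc)
    have x: "norm x < 1"
    proof -
      have "norm x \<le> norm y / 1"
        unfolding x_def norm_divide norm_of_nat by (rule frac_le) auto
      with ny show ?thesis by simp
    qed
    have nx: "norm (- x\<^sup>2) < 1"
      using x by (simp add: norm_power power_less_one_iff abs_square_less_1)
    have "(\<lambda>j. 2 * x\<^sup>2 * (- x\<^sup>2) ^ j) sums (2 * x\<^sup>2 * (1 / (1 - (- x\<^sup>2))))"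
      by (intro sums_mult geometric_sums nx)
    moreover have "2 * x\<^sup>2 * (- x\<^sup>2) ^ j = g n j" for j
      unfolding g_def x_def[symmetric] by (subst power_minus) (simp add: power_mult power2_eq_square power_mult_distrib)
    moreover have "2 * x\<^sup>2 * (1 / (1 - (- x\<^sup>2))) = z * (1 / (z + period (Suc n)) + 1 / (z - period (Suc n)))"
    proof -
      define q :: complex where "q = 2 * of_real pi * N"
      have q: "q \<noteq> 0" "z = q * x" "period (Suc n) = \<i> * q"
        using N by (simp_all add: q_def x_def y_def N_def)
      have nz: "x + \<i> \<noteq> 0" "x - \<i> \<noteq> 0"
        using x by (auto simp: add_eq_0_iff2 dest: arg_cong[where f = norm])
      have "z + period (Suc n) = (x + \<i>) * q" "z - period (Suc n) = (x - \<i>) * q"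
        unfolding q(3) unfolding q(2) by (simp_all only: ring_distribs mult.commute)
      then have "1 / (z + period (Suc n)) + 1 / (z - period (Suc n)) = (1 / (x + \<i>) + 1 / (x - \<i>)) / q"
        by (simp only: add_divide_distrib divide_divide_eq_left)
      also have "1 / (x + \<i>) + 1 / (x - \<i>) = (1 * (x - \<i>) + 1 * (x + \<i>)) / ((x + \<i>) * (x - \<i>))"
        using nz by (rule add_frac_eq)
      also have "\<dots> = 2 * x / (1 + x\<^sup>2)"
        by (simp add: algebra_simps power2_eq_square)
      finally show ?thesis
        using q by (simp add: power2_eq_square)
    qed
    ultimately show ?thesis by simp
  qed
  have "(\<Sum>j. g n j) = z * (1 / (z + period (Suc n)) + 1 / (z - period (Suc n)))" for n
    by (rule sums_unique[OF row, symmetric])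
  then have "infsum (\<lambda>(m, n). g m n) UNIV = z * (1 / (exp z - 1) + 1 / 2 - 1 / z)"
    using sums_unique2[OF summable_on_double_sums(3)[OF g]] S by simp
  then have "(\<lambda>j. \<Sum>n. g n j) sums (z * (1 / (exp z - 1) + 1 / 2 - 1 / z))"
    using summable_on_double_sums(4)[OF g] by simp
  moreover have "(\<Sum>n. g n j) = 2 * (-1) ^ j * zeta_nat (2 * Suc j) * y ^ (2 * Suc j)" for j
  proof -
    have "(\<lambda>n. (2 * (-1) ^ j * y ^ (2 * Suc j)) * (1 / of_nat (Suc n) ^ (2 * Suc j)))
            sums ((2 * (-1) ^ j * y ^ (2 * Suc j)) * zeta_nat (2 * Suc j))"
      by (intro sums_mult zeta_nat_sums) simp
    moreover have "(2 * (-1) ^ j * y ^ (2 * Suc j)) * (1 / of_nat (Suc n) ^ (2 * Suc j)) = g n j" for n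
      unfolding g_def power_divide by (simp only: times_divide_eq_right mult_1_right)
    ultimately show ?thesis
      by (simp only: sums_iff mult.assoc mult.commute mult.left_commute)
  qed
  moreover have "z * (1 / (exp z - 1) + 1 / 2 - 1 / z) = z / (exp z - 1) + z / 2 - 1"
    using assms(2) by (simp add: algebra_simps)
  ultimately show ?thesis
    by (simp add: y_def)
qed

text \<open>Compare the Taylor coefficients of \<open>z / (exp z - 1)\<close> just found with those
  of the generating function of the Bernoulli numbers.\<close>

lemma zeta_nat_even:
  assumes "j \<ge> 1"
  shows "zeta_nat (2 * j) = (-1) ^ Suc j * of_real (bernoulli (2 * j) / fact (2 * j)) * (2 * of_real pi) ^ (2 * j) / 2"
proof -
  define h :: "nat \<Rightarrow> complex" where
    "h = (\<lambda>n. if even n \<and> n \<ge> 2 then 2 * (-1) ^ (n div 2 - 1) * zeta_nat n / (2 * of_real pi) ^ n else 0)"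
  \<comment> \<open>The coefficients 1 and -1/2 come from moving \<open>z / 2 - 1\<close> to the
    other side of the expansion.\<close>
  define c :: "nat \<Rightarrow> complex" where "c = (\<lambda>n. if n \<in> {0, 1} then (if n = 0 then 1 else - 1 / 2) else h n)"
  define f :: "complex \<Rightarrow> complex" where "f = (\<lambda>z. if z = 0 then 1 else z / (exp z - 1))"
  have sums: "(\<lambda>n. c n * z ^ n) sums f z" if z: "norm z < 1" for z
  proof (cases "z = 0")
    case True
    have "(\<lambda>n. c n * 0 ^ n) sums c 0"
      by (rule powser_sums_zero)
    then show ?thesis
      using True by (simp add: c_def f_def)
  next
    case False
    have mono: "strict_mono (\<lambda>j :: nat. 2 * Suc j)"
      by (rule strict_monoI) simp
    have "h n * z ^ n = 0" if n: "n \<notin> range (\<lambda>j. 2 * Suc j)" for n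
    proof -
      have "\<not> (even n \<and> n \<ge> 2)"
      proof
        assume "even n \<and> n \<ge> 2"
        then have "n = 2 * Suc (n div 2 - 1)" by auto
        with n show False by blast
      qed
      then show ?thesis by (auto simp: h_def)
    qed
    moreover have h_eq: "h (2 * Suc j) * z ^ (2 * Suc j)
        = 2 * (-1) ^ j * zeta_nat (2 * Suc j) * (z / (2 * of_real pi)) ^ (2 * Suc j)" for j
    proof -
      have "h (2 * Suc j) = 2 * (-1) ^ j * zeta_nat (2 * Suc j) / (2 * of_real pi) ^ (2 * Suc j)"
        unfolding h_def by simp
      then show ?thesis
        unfolding power_divide by (simp only: times_divide_eq_right times_divide_eq_left)
    qed
    moreover have "(\<lambda>j. h (2 * Suc j) * z ^ (2 * Suc j)) sums (z / (exp z - 1) + z / 2 - 1)"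
      using bernoulli_function_expansion[OF z False] unfolding h_eq .
    ultimately have "(\<lambda>n. h n * z ^ n) sums (z / (exp z - 1) + z / 2 - 1)"
      using sums_mono_reindex[OF mono, of "\<lambda>n. h n * z ^ n"] by blast
    then have "(\<lambda>n. if n \<in> {0, 1} then (if n = 0 then 1 else - 1 / 2) * z ^ n else h n * z ^ n) sums f z"
      by (rule sums_If_finite_set') (use False in \<open>auto simp: f_def h_def\<close>)
    then show ?thesis
      by (rule sums_cong[THEN iffD1, rotated]) (auto simp: c_def)
  qed
  have "f has_fps_expansion Abs_fps c"
  proof (rule has_fps_expansionI)
    have "eventually (\<lambda>z :: complex. z \<in> ball 0 1) (nhds 0)"
      by (rule eventually_nhds_in_open) auto
    then show "eventually (\<lambda>z. (\<lambda>n. fps_nth (Abs_fps c) n * z ^ n) sums f z) (nhds 0)"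
      by eventually_elim (use sums in auto)
  qed
  \<comment> \<open>Multiplied by \<open>exp z - 1\<close>, both power series become
    \<open>z\<close>; formal power series have no zero divisors, so the factor cancels.\<close>
  then have A: "(\<lambda>z. (exp z - 1) * f z) has_fps_expansion (fps_exp 1 - 1) * Abs_fps c"
    by (intro fps_expansion_intros)
  have "(exp z - 1) * f z = z" if "norm z < 1" for z
  proof (cases "exp z = 1")
    case True
    then show ?thesis
      using exp_eq_1_unit_disc that by auto
  qed (auto simp: f_def)
  then have B: "\<forall>\<^sub>F z in nhds 0. (exp z - 1) * f z = z"
    using eventually_nhds_in_open[of "ball 0 1" "0 :: complex"] by (auto elim: eventually_mono)
  have "(\<lambda>z. z) has_fps_expansion (fps_exp 1 - 1) * Abs_fps c"
    by (rule has_fps_expansion_cong[OF B refl, THEN iffD1, OF A])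
  then have "(fps_exp 1 - 1) * Abs_fps c = fps_X"
    using fps_expansion_unique_complex has_fps_expansion_fps_X by blast
  also have "\<dots> = (fps_exp 1 - 1) * Abs_fps (\<lambda>n. of_real (bernoulli n / fact n))"
    by (rule bernoulli_fps_complex[symmetric])
  finally have "Abs_fps c = Abs_fps (\<lambda>n. of_real (bernoulli n / fact n))"
  proof (subst (asm) mult_left_cancel)
    show "fps_exp 1 - 1 \<noteq> (0 :: complex fps)"
      using bernoulli_fps_complex by force
  qed auto
  then have "c (2 * j) = of_real (bernoulli (2 * j) / fact (2 * j))"
    by (metis fps_nth_Abs_fps)
  moreover have "c (2 * j) = 2 * (-1) ^ (j - 1) * zeta_nat (2 * j) / (2 * of_real pi) ^ (2 * j)"
    using assms by (auto simp: c_def h_def)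
  moreover have "(-1) ^ (j - 1) = ((-1) ^ Suc j :: complex)"
    using assms by (cases j) auto
  ultimately have *: "of_real (bernoulli (2 * j) / fact (2 * j)) = 2 * (-1) ^ Suc j * zeta_nat (2 * j) / (2 * of_real pi) ^ (2 * j)"
    by metis
  have "(-1) ^ Suc j * (2 * (-1) ^ Suc j * Z / P) * P / 2 = Z" if "P \<noteq> 0" for Z P :: complex
    using that by (simp add: power_add[symmetric] flip: mult.assoc)
  then show ?thesis
    unfolding * by simp
qed

section \<open>The L-function and the Lambert series\<close>

definition chi :: "nat \<Rightarrow> nat \<Rightarrow> complex" where
  "chi p n = (if p dvd n then 0 else 1)"

text \<open>The numbers \<open>a_n\<close> of the theorem. For prime \<open>p\<close> they are the
  negatives of the Ramanujan sums modulo \<open>p\<close>, that is, of the finite Fourier transform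
  of \<open>chi p\<close>.\<close>

definition wt :: "nat \<Rightarrow> nat \<Rightarrow> complex" where
  "wt p n = (if p dvd n then 1 - of_nat p else 1)"

lemma principal_dchar_prime:
  assumes "prime p"
  shows "principal_dchar p n = chi p n"
proof -
  have "coprime n p \<longleftrightarrow> \<not> p dvd n"
  proof
    show "\<not> p dvd n" if "coprime n p"
      using coprime_common_divisor[OF that _ dvd_refl] assms not_prime_unit by blast
    show "coprime n p" if "\<not> p dvd n"
      using prime_imp_coprime[OF assms that] by (simp only: coprime_commute)
  qed
  then show ?thesis
    by (simp add: principal_dchar_def chi_def)
qed

lemma norm_chi_le: "norm (chi p n) \<le> 1"
  by (simp add: chi_def)

lemma norm_wt_le: "norm (wt p n) \<le> 1 + real p"
  using norm_triangle_ineq4[of 1 "of_nat p :: complex"] by (simp add: wt_def)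

lemma wt_mult_prime: "prime p \<Longrightarrow> \<not> p dvd d \<Longrightarrow> wt p (d * m) = wt p m"
  by (simp add: wt_def prime_dvd_mult_iff)

text \<open>\<open>chi p\<close> is 1 minus the indicator of the multiples of \<open>p\<close>, so
  the subseries over these multiples is subtracted. For \<open>wt p\<close> it is subtracted
  \<open>p\<close> times.\<close>

lemma sums_chi:
  assumes "(\<lambda>n. f (Suc n)) sums s" "(\<lambda>n. f (p * Suc n)) sums t" "p > 0"
  shows "(\<lambda>n. chi p (Suc n) * f (Suc n)) sums (s - t)"
proof -
  have "(\<lambda>n. f (Suc n) - (if p dvd Suc n then f (p * (Suc n div p)) else 0)) sums (s - t)"
    by (intro sums_diff assms sums_dvd[where h = "\<lambda>n. f (p * n)"])
  moreover have "f (Suc n) - (if p dvd Suc n then f (p * (Suc n div p)) else 0) = chi p (Suc n) * f (Suc n)" for n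
    by (simp add: chi_def)
  ultimately show ?thesis by simp
qed

lemma sums_wt:
  assumes "(\<lambda>n. f (Suc n)) sums s" "(\<lambda>n. f (p * Suc n)) sums t" "p > 0"
  shows "(\<lambda>n. wt p (Suc n) * f (Suc n)) sums (s - of_nat p * t)"
proof -
  have "(\<lambda>n. f (Suc n) - of_nat p * (if p dvd Suc n then f (p * (Suc n div p)) else 0)) sums (s - of_nat p * t)"
    by (intro sums_diff sums_mult assms sums_dvd[where h = "\<lambda>n. f (p * n)"])
  moreover have "f (Suc n) - of_nat p * (if p dvd Suc n then f (p * (Suc n div p)) else 0) = wt p (Suc n) * f (Suc n)" for n
    by (simp add: wt_def algebra_simps)
  ultimately show ?thesis by simp
qed

text \<open>\<open>entire_zeta s / (s - 1)\<close> is the zeta function, and the remaining factor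
  removes its Euler factor at \<open>p\<close>.\<close>

definition L_fun :: "nat \<Rightarrow> complex \<Rightarrow> complex" where
  "L_fun p s = (1 - of_nat p powr (- s)) * entire_zeta s / (s - 1)"

lemma L_fun_sums:
  assumes "p > 0" "Re s > 1"
  shows "(\<lambda>n. chi p (Suc n) / of_nat (Suc n) powr s) sums L_fun p s"
proof -
  have "(\<lambda>n. of_nat p powr (- s) * (1 / of_nat (Suc n) powr s)) sums (of_nat p powr (- s) * zeta_series s)"
    by (intro sums_mult zeta_series_sums assms)
  moreover have "of_nat p powr (- s) * (1 / of_nat (Suc n) powr s) = 1 / of_nat (p * Suc n) powr s" for n
  proof -
    have "of_nat (p * Suc n) powr s = of_nat p powr s * of_nat (Suc n) powr s"
      unfolding of_nat_mult by (rule powr_times_real) auto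
    then show ?thesis
      by (simp only: powr_minus inverse_eq_divide times_divide_times_eq mult_1)
  qed
  ultimately have "(\<lambda>n. 1 / of_nat (p * Suc n) powr s) sums (of_nat p powr (- s) * zeta_series s)"
    by simp
  from sums_chi[OF zeta_series_sums[OF assms(2)] this assms(1)]
  have "(\<lambda>n. chi p (Suc n) / of_nat (Suc n) powr s) sums (zeta_series s - of_nat p powr (- s) * zeta_series s)"
    by simp
  moreover have "L_fun p s = zeta_series s - of_nat p powr (- s) * zeta_series s"
  proof -
    have s: "s - 1 \<noteq> 0" using assms by auto
    have "(1 - q) * ((s - 1) * z) = (z - q * z) * (s - 1)" for q z
      by (simp add: algebra_simps)
    then have "(1 - q) * ((s - 1) * z) / (s - 1) = z - q * z" for q z
      using nonzero_mult_div_cancel_right[OF s] by metis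
    then show ?thesis
      unfolding L_fun_def entire_zeta_eq[OF assms(2)] by blast
  qed
  ultimately show ?thesis
    by simp
qed

lemma L_fun_analytic:
  assumes "p > 0" "s \<noteq> 1"
  shows "L_fun p analytic_on {s}"
proof -
  have "entire_zeta analytic_on {s}"
    using entire_zeta analytic_on_open[of UNIV] analytic_on_subset by blast
  then show ?thesis
    using assms unfolding L_fun_def by (intro analytic_intros) auto
qed

text \<open>\<open>L_fun p\<close> is analytic away from 1, so \<open>remove_sings\<close> can
  change at most its value at 1; it supplies the normalisation that \<open>is_dirichlet_L\<close>
  demands.\<close>

lemma is_dirichlet_L_principal:
  assumes "prime p"
  shows "is_dirichlet_L (principal_dchar p) (remove_sings (L_fun p))"
  unfolding is_dirichlet_L_def
proof (intro conjI allI impI)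
  have p: "p > 0" using assms prime_gt_0_nat by blast
  have "entire_zeta meromorphic_on UNIV"
    using entire_zeta analytic_on_open[of UNIV] by (intro analytic_on_imp_meromorphic_on) auto
  moreover have "(\<lambda>s. of_nat p powr (- s)) meromorphic_on UNIV"
    using p by (intro analytic_on_imp_meromorphic_on analytic_intros) auto
  ultimately have "L_fun p meromorphic_on UNIV"
    unfolding L_fun_def by (intro meromorphic_intros)
  then show "remove_sings (L_fun p) nicely_meromorphic_on UNIV"
    by (rule remove_sings_nicely_meromorphic)
  fix s :: complex assume s: "Re s > 1"
  then have "s \<noteq> 1" by auto
  then have "remove_sings (L_fun p) s = L_fun p s"
    using L_fun_analytic[OF p] by simp
  then show "(\<lambda>n. principal_dchar p (Suc n) / of_nat (Suc n) powr s) sums remove_sings (L_fun p) s"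
    using L_fun_sums[OF p s] by (simp only: principal_dchar_prime[OF assms])
qed

lemma dirichlet_L_principal:
  assumes "prime p" "s \<noteq> 1"
  shows "dirichlet_L s (principal_dchar p) = L_fun p s"
  using dirichlet_L_eqI[OF is_dirichlet_L_principal[OF assms(1)]] L_fun_analytic[of p s] assms prime_gt_0_nat
  by simp

text \<open>The inequality \<open>x ^ K / fact K \<le> exp x\<close> at
  \<open>x = N * \<alpha> / 2\<close> spends half of the exponential decay on the power and leaves a
  geometric series.\<close>

lemma summable_power_exp:
  assumes "\<alpha> > 0"
  shows "summable (\<lambda>n. real (Suc n) ^ K * exp (- real (Suc n) * \<alpha>))"
proof -
  have "x ^ K / fact K \<le> exp x" if "x \<ge> 0" for x :: real
  proof -
    have "(\<Sum>n\<in>{K}. x ^ n /\<^sub>R fact n) \<le> (\<Sum>n. x ^ n /\<^sub>R fact n)"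
      by (rule sum_le_suminf) (use that in \<open>auto intro: summable_exp\<close>)
    then show ?thesis
      by (simp add: exp_def divide_inverse mult.commute)
  qed
  note pe = this
  have bound: "real (Suc n) ^ K * exp (- real (Suc n) * \<alpha>) \<le> fact K * (2 / \<alpha>) ^ K * exp (- \<alpha> / 2) ^ n" for n
  proof -
    define N where "N = real (Suc n)"
    have "(N * (\<alpha> / 2)) ^ K / fact K \<le> exp (N * (\<alpha> / 2))"
      by (rule pe) (use assms in \<open>simp add: N_def\<close>)
    then have "N ^ K \<le> fact K * (2 / \<alpha>) ^ K * exp (N * (\<alpha> / 2))"
      using assms by (simp add: power_mult_distrib power_divide field_simps)
    then have "N ^ K * exp (- N * \<alpha>) \<le> fact K * (2 / \<alpha>) ^ K * exp (N * (\<alpha> / 2)) * exp (- N * \<alpha>)"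
      by (intro mult_right_mono) auto
    also have "\<dots> = fact K * (2 / \<alpha>) ^ K * exp (- N * (\<alpha> / 2))"
      unfolding mult.assoc mult_exp_exp by (simp add: algebra_simps)
    also have "\<dots> \<le> fact K * (2 / \<alpha>) ^ K * exp (real n * (- \<alpha> / 2))"
      using assms by (intro mult_left_mono) (auto simp: N_def algebra_simps)
    finally show ?thesis
      by (simp only: N_def exp_of_nat_mult)
  qed
  have "summable (\<lambda>n. fact K * (2 / \<alpha>) ^ K * exp (- \<alpha> / 2) ^ n)"
    using assms by (intro summable_mult summable_geometric) simp
  then show ?thesis
    by (rule summable_comparison_test') (use bound in \<open>simp del: of_nat_Suc\<close>)
qed

text \<open>The Lambert series unfolded over pairs: \<open>Suc d\<close> is the divisor,
  \<open>Suc m\<close> its cofactor in \<open>n\<close>. The weight is attached to the cofactor, so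
  that only the exponential couples the two indices.\<close>

definition lambert_term :: "nat \<Rightarrow> int \<Rightarrow> real \<Rightarrow> nat \<Rightarrow> nat \<Rightarrow> complex" where
  "lambert_term p e \<alpha> d m =
     chi p (Suc d) * wt p (Suc m) / of_nat (Suc d) powi e * of_real (exp (- 2 * real (Suc d * Suc m) * \<alpha>))"

lemma lambert_summable:
  assumes "\<alpha> > 0"
  shows "(\<lambda>(d, m). lambert_term p e \<alpha> d m) summable_on UNIV"
proof (rule summable_on_double_comparison)
  \<comment> \<open>The absolute value covers both signs of the exponent \<open>e\<close>.\<close>
  define K where "K = nat \<bar>e\<bar>"
  show "summable (\<lambda>d. real (Suc d) ^ K * exp (- real (Suc d) * \<alpha>))"
    by (rule summable_power_exp[OF assms])
  show "summable (\<lambda>m. (1 + real p) * exp (- real (Suc m) * \<alpha>))"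
    using summable_power_exp[OF assms, of 0] by (intro summable_mult) (simp only: power_0 mult_1)
  fix d m
  define D M where "D = real (Suc d)" and "M = real (Suc m)"
  have DM: "D \<ge> 1" "M \<ge> 1" by (simp_all add: D_def M_def)
  have 1: "norm (1 / of_nat (Suc d) powi e :: complex) \<le> D ^ K"
  proof -
    have "norm (1 / of_nat (Suc d) powi e :: complex) = D powi (- e)"
      unfolding norm_divide norm_power_int norm_of_nat D_def by (simp add: power_int_minus_divide)
    also have "\<dots> \<le> D powi (int K)"
      using DM by (intro power_int_increasing) (auto simp: K_def)
    finally show ?thesis by simp
  qed
  \<comment> \<open>This makes the exponential at most
    \<open>exp (- D * \<alpha>) * exp (- M * \<alpha>)\<close>, a majorant in product form.\<close>
  have "D + M \<le> 2 * (D * M)"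
  proof -
    have "M \<le> D * M" "D \<le> D * M" using DM by simp_all
    then show ?thesis by linarith
  qed
  then have "exp (- (2 * (D * M)) * \<alpha>) \<le> exp (- (D + M) * \<alpha>)"
    unfolding exp_le_cancel_iff using assms by (intro mult_right_mono) auto
  then have 2: "exp (- 2 * real (Suc d * Suc m) * \<alpha>) \<le> exp (- D * \<alpha>) * exp (- M * \<alpha>)"
    unfolding mult_exp_exp by (simp add: D_def M_def algebra_simps)
  have "norm (lambert_term p e \<alpha> d m)
      = norm (chi p (Suc d)) * norm (wt p (Suc m)) * norm (1 / of_nat (Suc d) powi e :: complex) * exp (- 2 * real (Suc d * Suc m) * \<alpha>)"
    unfolding lambert_term_def by (simp only: norm_mult norm_divide norm_of_real abs_exp_cancel norm_one times_divide_eq_right mult_1_right)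
  also have "\<dots> \<le> 1 * (1 + real p) * D ^ K * (exp (- D * \<alpha>) * exp (- M * \<alpha>))"
    using DM by (intro mult_mono norm_chi_le norm_wt_le 1 2 mult_nonneg_nonneg) auto
  finally show "norm (lambert_term p e \<alpha> d m) \<le> (real (Suc d) ^ K * exp (- real (Suc d) * \<alpha>)) * ((1 + real p) * exp (- real (Suc m) * \<alpha>))"
    unfolding D_def M_def by (simp only: mult_1 mult_ac)
qed auto

text \<open>Pairs of a number and one of its divisors correspond to pairs of divisor and cofactor.
  The weight of \<open>n = d * m\<close> passes to \<open>m\<close>: where \<open>chi p d\<close> is
  not zero, \<open>d\<close> is prime to \<open>p\<close>, and \<open>p\<close> divides
  \<open>d * m\<close> only if it divides \<open>m\<close>.\<close>

lemma lambert_divisor_sum: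
  assumes "prime p" "\<alpha> > 0" "\<And>n. n \<ge> 1 \<Longrightarrow> a n = wt p n"
  shows "(\<lambda>n. a (Suc n) * (\<Sum>d | d dvd Suc n. principal_dchar p d / of_nat d powi e) *
             of_real (exp (- 2 * of_nat (Suc n) * \<alpha>))) sums infsum (\<lambda>(d, m). lambert_term p e \<alpha> d m) UNIV"
proof -
  define f where "f = (\<lambda>(n, d). a (Suc n) * (principal_dchar p d / of_nat d powi e) * of_real (exp (- 2 * of_nat (Suc n) * \<alpha>)))"
  have "(f has_sum infsum (\<lambda>(d, m). lambert_term p e \<alpha> d m) UNIV) (Sigma UNIV (\<lambda>n. {d. d dvd Suc n}))
      \<longleftrightarrow> ((\<lambda>(d, m). lambert_term p e \<alpha> d m) has_sum infsum (\<lambda>(d, m). lambert_term p e \<alpha> d m) UNIV) UNIV"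
  proof (rule has_sum_reindex_bij_witness[of _ "\<lambda>(d, m). (Suc d * Suc m - 1, Suc d)" "\<lambda>(n, d). (d - 1, Suc n div d - 1)"])
    fix x :: "nat \<times> nat" assume "x \<in> Sigma UNIV (\<lambda>n. {d. d dvd Suc n})"
    then obtain n d where x: "x = (n, d)" "d dvd Suc n" by (cases x) auto
    then obtain m where m: "Suc n = d * m" by auto
    then have dm: "d > 0" "m > 0" by (auto intro: Nat.gr0I)
    then have e: "Suc (d - 1) = d" "Suc (m - 1) = m" "Suc n div d = m" using m by auto
    show "(case case x of (n, d) \<Rightarrow> (d - 1, Suc n div d - 1) of (d, m) \<Rightarrow> (Suc d * Suc m - 1, Suc d)) = x"
      unfolding x(1) prod.case e m[symmetric] by simp
    have "chi p d * wt p m = wt p (Suc n) * chi p d"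
      unfolding m using wt_mult_prime[OF assms(1), of d m] by (auto simp: chi_def)
    then show "(case (case x of (n, d) \<Rightarrow> (d - 1, Suc n div d - 1)) of (d, m) \<Rightarrow> lambert_term p e \<alpha> d m) = f x"
      unfolding x(1) prod.case lambert_term_def e f_def assms(3)[OF Suc_le_mono[THEN iffD2, OF le0, folded One_nat_def]] principal_dchar_prime[OF assms(1)] m[symmetric]
      by (simp only: times_divide_eq_right)
  next
    fix y :: "nat \<times> nat"
    obtain d m where y: "y = (d, m)" by (cases y)
    have *: "Suc (Suc d * Suc m - 1) = Suc d * Suc m" by simp
    show "(case case y of (d, m) \<Rightarrow> (Suc d * Suc m - 1, Suc d) of (n, d) \<Rightarrow> (d - 1, Suc n div d - 1)) = y"
      unfolding y prod.case * by (simp only: nonzero_mult_div_cancel_left nat.simps diff_Suc_1 not_False_eq_True)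
    show "(case y of (d, m) \<Rightarrow> (Suc d * Suc m - 1, Suc d)) \<in> Sigma UNIV (\<lambda>n. {d. d dvd Suc n})"
      unfolding y prod.case by (simp only: mem_Sigma_iff UNIV_I mem_Collect_eq * dvd_triv_left simp_thms)
  qed auto
  then have f: "(f has_sum infsum (\<lambda>(d, m). lambert_term p e \<alpha> d m) UNIV) (Sigma UNIV (\<lambda>n. {d. d dvd Suc n}))"
    using lambert_summable[OF assms(2), of p e] by simp
  have "((\<lambda>n. \<Sum>d | d dvd Suc n. f (n, d)) has_sum infsum (\<lambda>(d, m). lambert_term p e \<alpha> d m) UNIV) UNIV"
    by (rule has_sum_SigmaD[OF f]) (auto intro: has_sum_finite)
  moreover have "(\<Sum>d | d dvd Suc n. f (n, d)) = a (Suc n) * (\<Sum>d | d dvd Suc n. principal_dchar p d / of_nat d powi e) *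
             of_real (exp (- 2 * of_nat (Suc n) * \<alpha>))" for n
    unfolding f_def prod.case sum_distrib_left sum_distrib_right ..
  ultimately show ?thesis
    using has_sum_imp_sums by simp
qed

section \<open>Positive k\<close>

lemma exp_neq_1: "Re z > 0 \<Longrightarrow> exp z \<noteq> 1"
  by (metis norm_exp_eq_Re exp_eq_one_iff norm_one less_irrefl)

lemma wt_exp_sums:
  assumes "Re z > 0" "p > 0"
  shows "(\<lambda>m. wt p (Suc m) * exp (- of_nat (Suc m) * z)) sums (1 / (exp z - 1) - of_nat p * (1 / (exp (of_nat p * z) - 1)))"
proof (rule sums_wt)
  have "(\<lambda>m. exp (- of_nat (Suc m) * (of_nat p * z))) sums (1 / (exp (of_nat p * z) - 1))"
    by (rule geometric_exp_sums) (use assms in simp)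
  moreover have "- of_nat (Suc m) * (of_nat p * z) = - of_nat (p * Suc m) * z" for m
    by (simp add: algebra_simps)
  ultimately show "(\<lambda>m. exp (- of_nat (p * Suc m) * z)) sums (1 / (exp (of_nat p * z) - 1))"
    by (simp only:)
qed (use assms geometric_exp_sums in auto)

text \<open>The expansion at \<open>p z\<close>, multiplied by \<open>p\<close>, has its poles at
  the points \<open>2 pi i n / p\<close>; those with \<open>p\<close> dividing \<open>n\<close> form
  the expansion at \<open>z\<close>. In the difference the terms \<open>1 / z\<close> cancel and the
  constants leave \<open>(p - 1) / 2\<close>.\<close>

lemma chi_pfd_sums:
  assumes "Re z > 0" "p > 0"
  shows "(\<lambda>n. chi p (Suc n) * (1 / (z + period (Suc n) / of_nat p) + 1 / (z - period (Suc n) / of_nat p)))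
     sums ((of_nat p - 1) / 2 - (1 / (exp z - 1) - of_nat p * (1 / (exp (of_nat p * z) - 1))))"
proof -
  define P :: complex where "P = of_nat p"
  define f where "f = (\<lambda>n. 1 / (z + period n / P) + 1 / (z - period n / P))"
  have P: "P \<noteq> 0" using assms by (simp add: P_def)
  have z: "z \<noteq> 0" using assms by auto
  have "Re (P * z) > 0" using assms by (simp add: P_def)
  then have "(\<lambda>n. P * (1 / (P * z + period (Suc n)) + 1 / (P * z - period (Suc n)))) sums (P * (1 / (exp (P * z) - 1) + 1 / 2 - 1 / (P * z)))"
    by (intro sums_mult exp_pfd_sums exp_neq_1)
  moreover have "P * (1 / (P * z + c) + 1 / (P * z - c)) = 1 / (z + c / P) + 1 / (z - c / P)" for c
  proof -
    have c: "P * z + c = P * (z + c / P)" "P * z - c = P * (z - c / P)"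
      using P by (simp_all add: algebra_simps)
    have "P * (1 / (P * x)) = 1 / x" for x
      using P by simp
    then show ?thesis
      by (subst distrib_left) (simp only: c)
  qed
  ultimately have 1: "(\<lambda>n. f (Suc n)) sums (P * (1 / (exp (P * z) - 1) + 1 / 2 - 1 / (P * z)))"
    by (simp only: f_def)
  have "period (p * n) / P = period n" for n
    using P by (simp add: P_def)
  then have "f (p * Suc n) = 1 / (z + period (Suc n)) + 1 / (z - period (Suc n))" for n
    by (simp only: f_def)
  then have 2: "(\<lambda>n. f (p * Suc n)) sums (1 / (exp z - 1) + 1 / 2 - 1 / z)"
    using exp_pfd_sums[OF exp_neq_1[OF assms(1)]] by (simp only:)
  have "P * (x + 1 / 2 - 1 / (P * z)) - (y + 1 / 2 - 1 / z) = (P - 1) / 2 - (y - P * x)" for x y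
    using P z by (simp add: field_simps)
  with sums_chi[OF 1 2 assms(2)] show ?thesis
    by (simp only: f_def P_def)
qed

text \<open>Take \<open>z = 2 D \<alpha>\<close>. The relation between \<open>\<alpha>\<close> and
  \<open>\<beta>\<close> gives \<open>(2 pi n / p)^2 = 4 \<alpha> \<beta> n^2\<close>, so
  \<open>4 \<alpha>\<close> cancels from each combined pair of fractions.\<close>

lemma chi_square_sums:
  assumes "\<alpha> > 0" "\<beta> > 0" "\<alpha> * \<beta> = pi\<^sup>2 / (real p)\<^sup>2" "p > 0" "D > 0"
  shows "(\<lambda>n. chi p (Suc n) * of_real (D / (D\<^sup>2 * \<alpha> + (real (Suc n))\<^sup>2 * \<beta>)))
     sums ((of_nat p - 1) / 2 - (\<Sum>m. wt p (Suc m) * exp (- of_nat (Suc m) * of_real (2 * D * \<alpha>))))"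
proof -
  define z :: complex where "z = of_real (2 * D * \<alpha>)"
  have z: "Re z > 0" using assms by (simp add: z_def)
  have eq: "1 / (z + period n / of_nat p) + 1 / (z - period n / of_nat p) = of_real (D / (D\<^sup>2 * \<alpha> + (real n)\<^sup>2 * \<beta>))" for n
  proof -
    define c :: complex where "c = period n / of_nat p"
    have c: "Re c = 0" by (simp add: c_def)
    have nz: "z + c \<noteq> 0" "z - c \<noteq> 0"
      using z c by (auto simp: complex_eq_iff)
    have pos: "D\<^sup>2 * \<alpha> + (real n)\<^sup>2 * \<beta> > 0"
      using assms by (intro add_pos_nonneg) auto
    have "c\<^sup>2 = - of_real (4 * (pi\<^sup>2 / (real p)\<^sup>2) * (real n)\<^sup>2)"
      by (simp add: c_def power_divide power_mult_distrib)
    then have "c\<^sup>2 = - of_real (4 * \<alpha> * \<beta> * (real n)\<^sup>2)"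
      unfolding assms(3)[symmetric] by (simp only: mult.assoc)
    moreover have "z\<^sup>2 = of_real (4 * \<alpha> * (D\<^sup>2 * \<alpha>))"
      by (simp add: z_def power2_eq_square)
    moreover have "(z + c) * (z - c) = z\<^sup>2 - c\<^sup>2"
      by (simp add: algebra_simps power2_eq_square)
    ultimately have "(z + c) * (z - c) = of_real (4 * \<alpha> * (D\<^sup>2 * \<alpha> + (real n)\<^sup>2 * \<beta>))"
      by (simp add: algebra_simps)
    moreover have "1 / (z + c) + 1 / (z - c) = (1 * (z - c) + 1 * (z + c)) / ((z + c) * (z - c))"
      using nz by (rule add_frac_eq)
    moreover have "1 * (z - c) + 1 * (z + c) = of_real (4 * \<alpha> * D)"
      by (simp add: z_def)
    ultimately have "1 / (z + c) + 1 / (z - c) = of_real (4 * \<alpha> * D / (4 * \<alpha> * (D\<^sup>2 * \<alpha> + (real n)\<^sup>2 * \<beta>)))"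
      by (simp only: of_real_divide)
    also have "4 * \<alpha> * D / (4 * \<alpha> * (D\<^sup>2 * \<alpha> + (real n)\<^sup>2 * \<beta>)) = D / (D\<^sup>2 * \<alpha> + (real n)\<^sup>2 * \<beta>)"
      using assms pos by (subst mult_divide_mult_cancel_left) auto
    finally show ?thesis by (simp only: c_def)
  qed
  have "(\<Sum>m. wt p (Suc m) * exp (- of_nat (Suc m) * z)) = 1 / (exp z - 1) - of_nat p * (1 / (exp (of_nat p * z) - 1))"
    using wt_exp_sums[OF z assms(4)] by (simp only: sums_iff)
  with chi_pfd_sums[OF z assms(4)] show ?thesis
    unfolding eq by (simp only: z_def)
qed

text \<open>The exponent is \<open>2 k\<close> instead of \<open>2 k + 1\<close> because the
  numerator \<open>D\<close> of the partial fractions cancels one power.\<close>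

definition chi_lattice :: "nat \<Rightarrow> nat \<Rightarrow> real \<Rightarrow> real \<Rightarrow> nat \<Rightarrow> nat \<Rightarrow> complex" where
  "chi_lattice p k \<alpha> \<beta> d n =
     chi p (Suc d) * chi p (Suc n) * of_real (1 / (real (Suc d) ^ (2 * k) * ((real (Suc d))\<^sup>2 * \<alpha> + (real (Suc n))\<^sup>2 * \<beta>)))"

lemma norm_chi_chi_le: "norm (chi p m * chi p n * x) \<le> norm x"
  by (simp add: chi_def)

lemma chi_lattice_summable:
  assumes "\<alpha> > 0" "\<beta> > 0" "k \<ge> 1"
  shows "(\<lambda>(d, n). chi_lattice p k \<alpha> \<beta> d n) summable_on UNIV"
proof (rule summable_on_double_comparison)
  show "summable (\<lambda>d. 1 / real (Suc d) ^ 2)" "summable (\<lambda>n. 1 / \<beta> * (1 / real (Suc n) ^ 2))"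
    by (intro summable_mult summable_inverse_nat_power; simp)+
  fix d n
  define D N where "D = real (Suc d)" and "N = real (Suc n)"
  have DN: "D \<ge> 1" "N \<ge> 1" by (simp_all add: D_def N_def)
  have "norm (chi_lattice p k \<alpha> \<beta> d n) \<le> \<bar>1 / (D ^ (2 * k) * (D\<^sup>2 * \<alpha> + N\<^sup>2 * \<beta>))\<bar>"
    unfolding chi_lattice_def D_def[symmetric] N_def[symmetric] by (rule order.trans[OF norm_chi_chi_le]) (simp only: norm_of_real order.refl)
  also have "\<dots> = 1 / (D ^ (2 * k) * (D\<^sup>2 * \<alpha> + N\<^sup>2 * \<beta>))"
    using DN assms by simp
  \<comment> \<open>Dropping the summand with \<open>\<alpha>\<close> leaves a product;
    \<open>k \<ge> 1\<close> provides the quadratic decay in \<open>D\<close>.\<close>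
  also have "\<dots> \<le> 1 / (D ^ 2 * (N\<^sup>2 * \<beta>))"
  proof (rule frac_le)
    show "D ^ 2 * (N\<^sup>2 * \<beta>) \<le> D ^ (2 * k) * (D\<^sup>2 * \<alpha> + N\<^sup>2 * \<beta>)"
      using DN assms by (intro mult_mono power_increasing) auto
    show "0 < D ^ 2 * (N\<^sup>2 * \<beta>)"
      using DN assms by simp
  qed auto
  finally show "norm (chi_lattice p k \<alpha> \<beta> d n) \<le> 1 / real (Suc d) ^ 2 * (1 / \<beta> * (1 / real (Suc n) ^ 2))"
    unfolding D_def N_def by (simp only: times_divide_times_eq mult_1 mult_ac)
qed (use assms in auto)

text \<open>Multiply the partial fraction formula for each \<open>D\<close> by
  \<open>chi p D / D^(2k+1)\<close> and sum over \<open>D\<close>: the constant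
  \<open>(p - 1) / 2\<close> produces the L-value and the exponentials produce the Lambert
  series.\<close>

lemma lambert_eq_chi_lattice:
  assumes "\<alpha> > 0" "\<beta> > 0" "\<alpha> * \<beta> = pi\<^sup>2 / (real p)\<^sup>2" "p > 0" "k \<ge> 1"
  shows "(of_nat p - 1) / 2 * L_fun p (of_int (2 * int k + 1)) - infsum (\<lambda>(d, m). lambert_term p (2 * int k + 1) \<alpha> d m) UNIV
     = infsum (\<lambda>(d, n). chi_lattice p k \<alpha> \<beta> d n) UNIV"
proof -
  define e where "e = 2 * int k + 1"
  define c :: "nat \<Rightarrow> complex" where "c = (\<lambda>d. chi p (Suc d) / of_nat (Suc d) powi e)"
  define W where "W = (\<lambda>d. \<Sum>m. wt p (Suc m) * exp (- of_nat (Suc m) * of_real (2 * real (Suc d) * \<alpha>)))"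
  have "(\<lambda>d. chi p (Suc d) / of_nat (Suc d) powr of_int e) sums L_fun p (of_int e)"
    by (rule L_fun_sums) (use assms in \<open>auto simp: e_def\<close>)
  moreover have "of_nat (Suc d) powr of_int e = (of_nat (Suc d) powi e :: complex)" for d
    by (rule complex_powr_of_int) (simp del: of_nat_Suc)
  ultimately have L: "c sums L_fun p (of_int e)"
    unfolding c_def by (simp only:)
  have lam: "lambert_term p e \<alpha> d m = c d * (wt p (Suc m) * exp (- of_nat (Suc m) * of_real (2 * real (Suc d) * \<alpha>)))" for d m
  proof -
    have "complex_of_real (exp (- 2 * real (Suc d * Suc m) * \<alpha>)) = exp (- of_nat (Suc m) * of_real (2 * real (Suc d) * \<alpha>))"
      unfolding exp_of_real[symmetric] by (rule arg_cong[where f = exp]) (simp add: algebra_simps)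
    then show ?thesis
      unfolding lambert_term_def c_def by (simp only: times_divide_eq_left mult.assoc)
  qed
  have sW: "summable (\<lambda>m. wt p (Suc m) * exp (- of_nat (Suc m) * of_real (2 * real (Suc d) * \<alpha>)))" for d
    by (rule sums_summable[OF wt_exp_sums]) (use assms in auto)
  have "(\<Sum>m. lambert_term p e \<alpha> d m) = c d * W d" for d
    unfolding lam W_def by (rule suminf_mult[OF sW])
  then have S: "(\<lambda>d. c d * W d) sums infsum (\<lambda>(d, m). lambert_term p e \<alpha> d m) UNIV"
    using summable_on_double_sums(3)[OF lambert_summable[OF assms(1)], of p e] by (simp only:)
  have "(\<lambda>d. (of_nat p - 1) / 2 * c d - c d * W d) sums
      ((of_nat p - 1) / 2 * L_fun p (of_int e) - infsum (\<lambda>(d, m). lambert_term p e \<alpha> d m) UNIV)"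
    by (intro sums_diff sums_mult L S)
  moreover have "(of_nat p - 1) / 2 * c d - c d * W d = (\<Sum>n. chi_lattice p k \<alpha> \<beta> d n)" for d
  proof -
    define D where "D = real (Suc d)"
    have D: "D > 0" by (simp add: D_def)
    have "(\<lambda>n. c d * (chi p (Suc n) * of_real (D / (D\<^sup>2 * \<alpha> + (real (Suc n))\<^sup>2 * \<beta>)))) sums (c d * ((of_nat p - 1) / 2 - W d))"
      unfolding W_def D_def[symmetric] by (intro sums_mult chi_square_sums assms D)
    moreover have "c d * (chi p (Suc n) * of_real (D / (D\<^sup>2 * \<alpha> + (real (Suc n))\<^sup>2 * \<beta>))) = chi_lattice p k \<alpha> \<beta> d n" for n
    proof -
      define X where "X = D\<^sup>2 * \<alpha> + (real (Suc n))\<^sup>2 * \<beta>"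
      have "of_nat (Suc d) powi e = (of_real (D ^ Suc (2 * k)) :: complex)"
      proof -
        have "e = int (Suc (2 * k))" by (simp add: e_def)
        then show ?thesis
          unfolding D_def by (simp only: power_int_of_nat of_real_power of_real_of_nat_eq)
      qed
      then have "c d = chi p (Suc d) * of_real (1 / D ^ Suc (2 * k))"
        by (simp only: c_def of_real_divide of_real_1 times_divide_eq_right mult_1_right)
      then have "c d * (chi p (Suc n) * of_real (D / X)) = chi p (Suc d) * chi p (Suc n) * of_real (1 / D ^ Suc (2 * k) * (D / X))"
        by (simp only: of_real_mult mult_ac)
      also have "1 / D ^ Suc (2 * k) * (D / X) = 1 / (D ^ (2 * k) * X)"
        using D by simp
      finally show ?thesis
        unfolding chi_lattice_def D_def[symmetric] X_def[symmetric] .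
    qed
    ultimately show ?thesis
      by (simp only: sums_iff right_diff_distrib mult.commute)
  qed
  ultimately have "(\<lambda>d. \<Sum>n. chi_lattice p k \<alpha> \<beta> d n) sums
      ((of_nat p - 1) / 2 * L_fun p (of_int e) - infsum (\<lambda>(d, m). lambert_term p e \<alpha> d m) UNIV)"
    by (simp only:)
  then show ?thesis
    unfolding e_def[symmetric]
    using summable_on_double_sums(3)[OF chi_lattice_summable[OF assms(1,2,5)], of p] sums_unique2 by blast
qed


text \<open>The value of the L-function at \<open>2 i\<close>: Euler's formula times the Euler
  factor at \<open>p\<close>.\<close>

lemma chi_zeta_even_sums:
  assumes "p > 0" "i \<ge> 1"
  shows "(\<lambda>n. chi p (Suc n) * of_real (1 / real (Suc n) ^ (2 * i))) sums
    of_real ((1 - 1 / real p ^ (2 * i)) * ((-1) ^ Suc i * (bernoulli (2 * i) / fact (2 * i)) * (2 * pi) ^ (2 * i) / 2))"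
proof -
  have s: "(\<lambda>n. of_real (1 / real (Suc n) ^ (2 * i)) :: complex) sums zeta_nat (2 * i)"
    using zeta_nat_sums[of "2 * i"] assms by simp
  have "of_real (1 / real (p * Suc n) ^ (2 * i)) = (of_real (1 / real p ^ (2 * i)) * of_real (1 / real (Suc n) ^ (2 * i)) :: complex)" for n
    unfolding of_real_mult[symmetric] of_nat_mult power_mult_distrib times_divide_times_eq mult_1 ..
  then have "(\<lambda>n. of_real (1 / real (p * Suc n) ^ (2 * i)) :: complex) sums (of_real (1 / real p ^ (2 * i)) * zeta_nat (2 * i))"
    using sums_mult[OF s] by (simp only:)
  moreover have z: "zeta_nat (2 * i) = of_real ((-1) ^ Suc i * (bernoulli (2 * i) / fact (2 * i)) * (2 * pi) ^ (2 * i) / 2)"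
    unfolding zeta_nat_even[OF assms(2)] by simp
  ultimately have this': "(\<lambda>n. of_real (1 / real (p * Suc n) ^ (2 * i)) :: complex) sums (of_real (1 / real p ^ (2 * i)) * zeta_nat (2 * i))"
    by blast
  from sums_chi[OF s this' assms(1)]
  show ?thesis
    unfolding z by (simp only: left_diff_distrib mult_1 of_real_diff of_real_mult)
qed

text \<open>With \<open>a = 1 / X\<close> and \<open>b = - 1 / Y\<close> one has
  \<open>a - b = (X + Y) / (X Y)\<close>. So \<open>X + Y\<close> cancels from the factorisation of
  \<open>a ^ k - b ^ k\<close>, leaving the geometric sum.\<close>

lemma power_diff_two_squares:
  fixes X Y :: real
  assumes "X > 0" "Y > 0"
  shows "(1 / X ^ k - (-1) ^ k / Y ^ k) / (X + Y) = (\<Sum>j=1..k. (-1) ^ (j - 1) * (1 / X ^ (k + 1 - j)) * (1 / Y ^ j))"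
proof -
  define a b where "a = 1 / X" and "b = (- 1) / Y"
  have "1 / X ^ k - (-1) ^ k / Y ^ k = a ^ k - b ^ k"
    unfolding a_def b_def power_divide by simp
  also have "\<dots> = - ((b - a) * (\<Sum>i<k. a ^ (k - Suc i) * b ^ i))"
    using power_diff_sumr2[of b k a] by simp
  also have "\<dots> / (X + Y) = (\<Sum>i<k. (1 / (X * Y)) * (a ^ (k - Suc i) * b ^ i))"
  proof -
    have "a - b = (X + Y) * (1 / (X * Y))"
      using assms by (simp add: a_def b_def field_simps)
    moreover have "X + Y \<noteq> 0" using assms by simp
    ultimately show ?thesis
      unfolding sum_distrib_left[symmetric] minus_mult_left minus_diff_eq by simp
  qed
  also have "\<dots> = (\<Sum>i<k. (-1) ^ (Suc i - 1) * (1 / X ^ (k + 1 - Suc i)) * (1 / Y ^ Suc i))"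
  proof (rule sum.cong)
    fix i assume "i \<in> {..<k}"
    then have "k + 1 - Suc i = Suc (k - Suc i)" by auto
    then have "1 / X ^ (k + 1 - Suc i) = a * a ^ (k - Suc i)"
      by (simp add: a_def power_divide)
    moreover have "b ^ i = (-1) ^ i * (1 / Y ^ i)"
      unfolding b_def power_divide by simp
    ultimately show "(1 / (X * Y)) * (a ^ (k - Suc i) * b ^ i) = (-1) ^ (Suc i - 1) * (1 / X ^ (k + 1 - Suc i)) * (1 / Y ^ Suc i)"
      by (simp add: a_def mult_ac)
  qed simp
  also have "\<dots> = (\<Sum>j=1..k. (-1) ^ (j - 1) * (1 / X ^ (k + 1 - j)) * (1 / Y ^ j))"
    by (rule sum.reindex_bij_witness[of _ "\<lambda>j. j - 1" Suc]) auto
  finally show ?thesis .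
qed

text \<open>For \<open>X = \<alpha> D^2\<close> and \<open>Y = \<beta> N^2\<close> both terms have
  the denominator factor \<open>X + Y\<close>, because the indices of the second are exchanged. The
  geometric sum then separates \<open>d\<close> from \<open>n\<close>.\<close>

lemma chi_lattice_identity:
  assumes "\<alpha> > 0" "\<beta> > 0"
  shows "of_real (1 / (4 * \<alpha>) ^ k) * chi_lattice p k \<alpha> \<beta> d n - of_real (1 / (- 4 * \<beta>) ^ k) * chi_lattice p k \<beta> \<alpha> n d
     = (\<Sum>j=1..k. of_real ((-1) ^ (j - 1) / (4 ^ k * \<alpha> ^ (k + 1 - j) * \<beta> ^ j)) *
          (chi p (Suc d) * of_real (1 / real (Suc d) ^ (2 * (k + 1 - j)))) * (chi p (Suc n) * of_real (1 / real (Suc n) ^ (2 * j))))"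
proof -
  define D N where "D = real (Suc d)" and "N = real (Suc n)"
  define X Y where "X = \<alpha> * D\<^sup>2" and "Y = \<beta> * N\<^sup>2"
  have DN: "D > 0" "N > 0" by (simp_all add: D_def N_def)
  have XY: "X > 0" "Y > 0" using DN assms by (simp_all add: X_def Y_def)
  have m: "(-1) ^ k / (4 * \<beta>) ^ k = 1 / (- 4 * \<beta>) ^ k"
    using assms by (cases "even k") (auto simp: power_minus_odd simp flip: minus_mult_left)
  have "1 / (4 * \<alpha>) ^ k * (1 / (D ^ (2 * k) * (D\<^sup>2 * \<alpha> + N\<^sup>2 * \<beta>))) - 1 / (- 4 * \<beta>) ^ k * (1 / (N ^ (2 * k) * (N\<^sup>2 * \<beta> + D\<^sup>2 * \<alpha>)))
      = 1 / 4 ^ k * ((1 / X ^ k - (-1) ^ k / Y ^ k) / (X + Y))"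
  proof -
    have "X ^ k = \<alpha> ^ k * D ^ (2 * k)" "Y ^ k = \<beta> ^ k * N ^ (2 * k)"
      by (simp_all add: X_def Y_def power_mult_distrib power_mult)
    moreover have "D\<^sup>2 * \<alpha> + N\<^sup>2 * \<beta> = X + Y" "N\<^sup>2 * \<beta> + D\<^sup>2 * \<alpha> = X + Y"
      by (simp_all add: X_def Y_def)
    moreover have "1 / (a * b) * (1 / (d * s)) - m / (a * b') * (1 / (n * s)) = 1 / a * ((1 / (b * d) - m / (b' * n)) / s)" for a b d s m b' n :: real
      by (simp add: diff_divide_distrib right_diff_distrib mult.assoc)
    ultimately show ?thesis
      unfolding m[symmetric] unfolding power_mult_distrib by (simp only:)
  qed
  also have "\<dots> = (\<Sum>j=1..k. 1 / 4 ^ k * ((-1) ^ (j - 1) * (1 / X ^ (k + 1 - j)) * (1 / Y ^ j)))"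
    unfolding power_diff_two_squares[OF XY] sum_distrib_left ..
  also have "\<dots> = (\<Sum>j=1..k. (-1) ^ (j - 1) / (4 ^ k * \<alpha> ^ (k + 1 - j) * \<beta> ^ j) * (1 / D ^ (2 * (k + 1 - j))) * (1 / N ^ (2 * j)))"
  proof (rule sum.cong)
    fix j
    have "X ^ i = \<alpha> ^ i * D ^ (2 * i)" "Y ^ i = \<beta> ^ i * N ^ (2 * i)" for i
      by (simp_all add: X_def Y_def power_mult_distrib power_mult)
    then show "1 / 4 ^ k * ((-1) ^ (j - 1) * (1 / X ^ (k + 1 - j)) * (1 / Y ^ j))
       = (-1) ^ (j - 1) / (4 ^ k * \<alpha> ^ (k + 1 - j) * \<beta> ^ j) * (1 / D ^ (2 * (k + 1 - j))) * (1 / N ^ (2 * j))"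
      by (simp only: times_divide_times_eq mult_1 mult_1_right times_divide_eq_right times_divide_eq_left divide_divide_eq_left mult_ac)
  qed simp
  finally have eq: "1 / (4 * \<alpha>) ^ k * (1 / (D ^ (2 * k) * (D\<^sup>2 * \<alpha> + N\<^sup>2 * \<beta>))) - 1 / (- 4 * \<beta>) ^ k * (1 / (N ^ (2 * k) * (N\<^sup>2 * \<beta> + D\<^sup>2 * \<alpha>)))
     = (\<Sum>j=1..k. (-1) ^ (j - 1) / (4 ^ k * \<alpha> ^ (k + 1 - j) * \<beta> ^ j) * (1 / D ^ (2 * (k + 1 - j))) * (1 / N ^ (2 * j)))" .
  show ?thesis
  proof (cases "p dvd Suc d \<or> p dvd Suc n")
    case True
    then show ?thesis
      by (auto simp: chi_lattice_def chi_def)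
  next
    case False
    then have "chi p (Suc d) = 1" "chi p (Suc n) = 1"
      by (simp_all add: chi_def)
    then show ?thesis
      unfolding chi_lattice_def D_def[symmetric] N_def[symmetric]
      by (simp only: mult_1 of_real_mult[symmetric] of_real_diff[symmetric] of_real_sum[symmetric] eq)
  qed
qed

text \<open>Sum the termwise identity over \<open>n\<close> and then over \<open>d\<close>, the
  first double series by rows and the second by columns. Each separated term becomes a product of
  two values \<open>V i\<close> of the L-function at \<open>2 i\<close>.\<close>

lemma chi_lattice_transformation:
  assumes "\<alpha> > 0" "\<beta> > 0" "\<alpha> * \<beta> = pi\<^sup>2 / (real p)\<^sup>2" "p > 0" "k \<ge> 1"
  shows "of_real (1 / (4 * \<alpha>) ^ k) * infsum (\<lambda>(d, n). chi_lattice p k \<alpha> \<beta> d n) UNIV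
       - of_real (1 / (- 4 * \<beta>) ^ k) * infsum (\<lambda>(d, n). chi_lattice p k \<beta> \<alpha> d n) UNIV
     = of_real (\<Sum>j = 1..k. (- 1) ^ (j - 1) *
       (real p ^ (2 * j) - 1) * (real p ^ (2 * k + 2 - 2 * j) - 1) *
       (bernoulli (2 * j) / fact (2 * j)) *
       (bernoulli (2 * k + 2 - 2 * j) / fact (2 * k + 2 - 2 * j)) *
       \<alpha> ^ (k + 1 - j) * \<beta> ^ j)"
proof -
  define A B :: complex where "A = of_real (1 / (4 * \<alpha>) ^ k)" and "B = of_real (1 / (- 4 * \<beta>) ^ k)"
  define b where "b = (\<lambda>i. bernoulli (2 * i) / fact (2 * i))"
  define V where "V = (\<lambda>i. (1 - 1 / real p ^ (2 * i)) * ((-1) ^ Suc i * b i * (2 * pi) ^ (2 * i) / 2))"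
  define u where "u = (\<lambda>i n. chi p (Suc n) * of_real (1 / real (Suc n) ^ (2 * i)))"
  define c where "c = (\<lambda>j. (-1) ^ (j - 1) / (4 ^ k * \<alpha> ^ (k + 1 - j) * \<beta> ^ j))"
  have u: "u i sums of_real (V i)" if "i \<ge> 1" for i
    using chi_zeta_even_sums[OF assms(4) that] by (simp only: u_def V_def b_def)
  note f = summable_on_double_sums[OF chi_lattice_summable[OF assms(1,2,5), of p]]
  note h = summable_on_double_sums[OF chi_lattice_summable[OF assms(2,1,5), of p]]
  have "(\<lambda>d. A * (\<Sum>n. chi_lattice p k \<alpha> \<beta> d n) - B * (\<Sum>n. chi_lattice p k \<beta> \<alpha> n d)) sums
      (A * infsum (\<lambda>(d, n). chi_lattice p k \<alpha> \<beta> d n) UNIV - B * infsum (\<lambda>(d, n). chi_lattice p k \<beta> \<alpha> d n) UNIV)"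
    by (intro sums_diff sums_mult f(3) h(4))
  moreover have "A * (\<Sum>n. chi_lattice p k \<alpha> \<beta> d n) - B * (\<Sum>n. chi_lattice p k \<beta> \<alpha> n d)
      = (\<Sum>j=1..k. of_real (c j) * u (k + 1 - j) d * of_real (V j))" for d
  proof -
    have "(\<lambda>n. A * chi_lattice p k \<alpha> \<beta> d n - B * chi_lattice p k \<beta> \<alpha> n d) sums
       (A * (\<Sum>n. chi_lattice p k \<alpha> \<beta> d n) - B * (\<Sum>n. chi_lattice p k \<beta> \<alpha> n d))"
      by (intro sums_diff sums_mult summable_sums f(1) h(2))
    moreover have "(\<lambda>n. \<Sum>j=1..k. of_real (c j) * u (k + 1 - j) d * u j n) sums
      (\<Sum>j=1..k. of_real (c j) * u (k + 1 - j) d * of_real (V j))"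
      by (intro sums_sum sums_mult u) auto
    ultimately show ?thesis
      unfolding A_def B_def chi_lattice_identity[OF assms(1,2)] u_def c_def by (rule sums_unique2)
  qed
  moreover have "(\<lambda>d. \<Sum>j=1..k. of_real (c j) * u (k + 1 - j) d * of_real (V j)) sums
      (\<Sum>j=1..k. of_real (c j) * of_real (V (k + 1 - j)) * of_real (V j))"
    by (intro sums_sum sums_mult sums_mult2 u) auto
  ultimately have "A * infsum (\<lambda>(d, n). chi_lattice p k \<alpha> \<beta> d n) UNIV - B * infsum (\<lambda>(d, n). chi_lattice p k \<beta> \<alpha> d n) UNIV
      = (\<Sum>j=1..k. of_real (c j) * of_real (V (k + 1 - j)) * of_real (V j))"
    by (simp only: sums_unique2)
  also have "\<dots> = of_real (\<Sum>j=1..k. c j * V (k + 1 - j) * V j)"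
    by simp
  also have "(\<Sum>j=1..k. c j * V (k + 1 - j) * V j) = (\<Sum>j=1..k. (- 1) ^ (j - 1) *
       (real p ^ (2 * j) - 1) * (real p ^ (2 * k + 2 - 2 * j) - 1) *
       (bernoulli (2 * j) / fact (2 * j)) *
       (bernoulli (2 * k + 2 - 2 * j) / fact (2 * k + 2 - 2 * j)) *
       \<alpha> ^ (k + 1 - j) * \<beta> ^ j)"
  \<comment> \<open>The two L-values contribute \<open>(\<alpha> \<beta>)^(k+1)\<close>, which turns
    the denominator \<open>\<alpha>^(k+1-j) \<beta>^j\<close> into the factor
    \<open>\<alpha>^j \<beta>^(k+1-j)\<close>. The reflection of \<open>j\<close> restores the order
    of the claim.\<close>
  proof (rule sum.reindex_bij_witness[of _ "\<lambda>j. k + 1 - j" "\<lambda>j. k + 1 - j"])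
    fix j assume "j \<in> {1..k}"
    then have j: "1 \<le> j" "j \<le> k" by auto
    define i where "i = k + 1 - j"
    have i: "i = k + 1 - j" "j = k + 1 - i" "i \<ge> 1" "j \<ge> 1" "k + 1 = i + j"
      using j by (auto simp: i_def)
    define P where "P = real p"
    have P: "P > 0" using assms by (simp add: P_def)
    have V: "V l = (P ^ (2 * l) - 1) * (-1) ^ Suc l * b l * (pi ^ 2 / P ^ 2) ^ l * 4 ^ l / 2" for l
    proof -
      have "1 - 1 / P ^ (2 * l) = (P ^ (2 * l) - 1) / P ^ (2 * l)"
        using P by (simp add: diff_divide_distrib)
      moreover have "(2 * pi) ^ (2 * l) = 4 ^ l * (pi ^ 2) ^ l"
        by (simp add: power_mult power_mult_distrib)
      moreover have "(pi ^ 2 / P ^ 2) ^ l = (pi ^ 2) ^ l / P ^ (2 * l)"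
        by (simp add: power_divide power_mult)
      ultimately show ?thesis
        unfolding V_def P_def[symmetric] by (simp only: times_divide_eq_left times_divide_eq_right mult_ac)
    qed
    have s: "(-1) ^ (j - 1) * ((-1) ^ Suc i * (-1) ^ Suc j) = ((-1) ^ (i - 1) :: real)"
    proof -
      obtain i' j' where "i = Suc i'" "j = Suc j'" using i by (metis Suc_le_D One_nat_def)
      then show ?thesis by (cases "even i'"; cases "even j'") simp_all
    qed
    \<comment> \<open>The surplus factor 4 is absorbed by the two factors 1/2 in \<open>V i\<close>
      and \<open>V j\<close>.\<close>
    have 4: "4 ^ i * 4 ^ j = (4 * 4 ^ k :: real)"
      using i(5) by (simp flip: power_add power_Suc)
    have ab: "(pi ^ 2 / P ^ 2) ^ l = \<alpha> ^ l * \<beta> ^ l" for l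
      unfolding P_def assms(3)[symmetric] by (rule power_mult_distrib)
    have "c j * V i * V j
       = ((-1) ^ (j - 1) * ((-1) ^ Suc i * (-1) ^ Suc j)) * (P ^ (2 * i) - 1) * (P ^ (2 * j) - 1) * b i * b j
         * ((\<alpha> ^ i * \<beta> ^ i) * (\<alpha> ^ j * \<beta> ^ j) / (\<alpha> ^ i * \<beta> ^ j)) * ((4 ^ i * 4 ^ j) / (4 ^ k * 4))"
      unfolding V ab c_def i(1)[symmetric] by simp
    also have "\<dots> = (-1) ^ (i - 1) * (P ^ (2 * i) - 1) * (P ^ (2 * j) - 1) * b i * b j * (\<alpha> ^ j * \<beta> ^ i)"
      unfolding s 4 using assms by simp
    finally have "c j * V i * V j = (-1) ^ (i - 1) * (P ^ (2 * i) - 1) * (P ^ (2 * j) - 1) * b i * b j * \<alpha> ^ j * \<beta> ^ i"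
      by (simp only: mult.assoc)
    moreover have "2 * k + 2 - 2 * i = 2 * j"
      using i(5) by simp
    ultimately show "(- 1) ^ ((k + 1 - j) - 1) *
       (real p ^ (2 * (k + 1 - j)) - 1) * (real p ^ (2 * k + 2 - 2 * (k + 1 - j)) - 1) *
       (bernoulli (2 * (k + 1 - j)) / fact (2 * (k + 1 - j))) *
       (bernoulli (2 * k + 2 - 2 * (k + 1 - j)) / fact (2 * k + 2 - 2 * (k + 1 - j))) *
       \<alpha> ^ (k + 1 - (k + 1 - j)) * \<beta> ^ (k + 1 - j) = c j * V (k + 1 - j) * V j"
      unfolding i(1)[symmetric] i(2)[symmetric] by (simp only: P_def b_def)
  qed auto
  finally show ?thesis
    by (simp only: A_def B_def)
qed

section \<open>Negative k\<close>

text \<open>Here \<open>w\<close> and \<open>v\<close> stand for the square roots of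
  \<open>\<alpha>\<close> and \<open>\<beta>\<close>; the two fractions belong to \<open>N\<close>
  and \<open>- N\<close>.\<close>

definition lattice_pair :: "nat \<Rightarrow> real \<Rightarrow> real \<Rightarrow> real \<Rightarrow> real \<Rightarrow> complex" where
  "lattice_pair m w v L N = 1 / (of_real (L * w) + \<i> * of_real (N * v)) ^ (2 * m)
                          + 1 / (of_real (L * w) - \<i> * of_real (N * v)) ^ (2 * m)"

text \<open>Because \<open>N v + i L w = i (L w - i N v)\<close>, and similarly for the conjugate,
  exchanging the roles costs \<open>i^(2m) = (-1)^m\<close>. This is the source of the sign in front
  of the \<open>\<beta>\<close> side.\<close>

lemma lattice_pair_swap: "lattice_pair m v w N L = (-1) ^ m * lattice_pair m w v L N"
proof -
  define x y :: complex where "x = of_real (L * w)" and "y = of_real (N * v)"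
  have "y + \<i> * x = \<i> * (x - \<i> * y)" "y - \<i> * x = - \<i> * (x + \<i> * y)"
    by (simp_all add: algebra_simps)
  moreover have "(\<i> * X) ^ (2 * m) = (-1) ^ m * X ^ (2 * m)" "(- \<i> * X) ^ (2 * m) = (-1) ^ m * X ^ (2 * m)" for X
    unfolding power_mult_distrib by (simp_all add: power_mult)
  moreover have "1 / ((-1) ^ m * X) = (-1) ^ m * (1 / X)" for X :: complex
    by (cases "even m") auto
  ultimately show ?thesis
    unfolding lattice_pair_def x_def[symmetric] y_def[symmetric] by (subst distrib_left) (simp only: add.commute)
qed

section \<open>The Lipschitz formula with weights\<close>

definition chi_exp_sum :: "nat \<Rightarrow> nat \<Rightarrow> complex \<Rightarrow> complex" where
  "chi_exp_sum p j z = (\<Sum>d. chi p (Suc d) * (of_nat (Suc d) ^ j * exp (- of_nat (Suc d) * z)))"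

lemma summable_complex_power_exp:
  fixes z :: complex
  assumes "Re z > 0"
  shows "summable (\<lambda>d. of_nat (Suc d) ^ j * exp (- of_nat (Suc d) * z))"
proof (rule summable_norm_cancel)
  have "norm (of_nat (Suc d) ^ j * exp (- of_nat (Suc d) * z)) = real (Suc d) ^ j * exp (- real (Suc d) * Re z)" for d
    unfolding norm_mult norm_power norm_of_nat norm_exp_eq_Re by (simp del: of_nat_Suc)
  then show "summable (\<lambda>d. norm (of_nat (Suc d) ^ j * exp (- of_nat (Suc d) * z)))"
    using summable_power_exp[OF assms] by (simp only:)
qed

definition power_exp_sum :: "nat \<Rightarrow> complex \<Rightarrow> complex" where
  "power_exp_sum j z = (\<Sum>d. of_nat (Suc d) ^ j * exp (- of_nat (Suc d) * z))"

lemma chi_exp_sum_eq: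
  fixes z :: complex
  assumes "Re z > 0" "p > 0"
  shows "(\<lambda>d. chi p (Suc d) * (of_nat (Suc d) ^ j * exp (- of_nat (Suc d) * z))) sums (power_exp_sum j z - of_nat p ^ j * power_exp_sum j (of_nat p * z))"
proof (rule sums_chi)
  show "(\<lambda>d. of_nat (Suc d) ^ j * exp (- of_nat (Suc d) * z)) sums power_exp_sum j z"
    unfolding power_exp_sum_def by (rule summable_sums[OF summable_complex_power_exp[OF assms(1)]])
  have "Re (of_nat p * z) > 0" using assms by simp
  then have "(\<lambda>d. of_nat p ^ j * (of_nat (Suc d) ^ j * exp (- of_nat (Suc d) * (of_nat p * z)))) sums (of_nat p ^ j * power_exp_sum j (of_nat p * z))"
    unfolding power_exp_sum_def by (intro sums_mult summable_sums summable_complex_power_exp)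
  moreover have "of_nat p ^ j * (of_nat (Suc d) ^ j * exp (- of_nat (Suc d) * (of_nat p * z)))
      = of_nat (p * Suc d) ^ j * exp (- of_nat (p * Suc d) * z)" for d
  proof -
    have "- of_nat (Suc d) * (of_nat p * z) = - of_nat (p * Suc d) * z"
      by (simp add: algebra_simps)
    then show ?thesis
      by (simp only: of_nat_mult power_mult_distrib mult.assoc)
  qed
  ultimately show "(\<lambda>d. of_nat (p * Suc d) ^ j * exp (- of_nat (p * Suc d) * z)) sums (of_nat p ^ j * power_exp_sum j (of_nat p * z))"
    by (simp only:)
qed (use assms in auto)

text \<open>Lipschitz' formula at \<open>p z\<close>, rescaled, runs over all
  \<open>2 pi i n / p\<close>; the terms with \<open>p\<close> dividing \<open>n\<close> are the
  formula at \<open>z\<close>. Removing these \<open>p\<close> times puts \<open>wt p\<close> on the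
  lattice side and \<open>chi p\<close> on the exponential side.\<close>

lemma wt_lipschitz_sums:
  assumes "Re z > 0" "p > 0" "m \<ge> 1"
  shows "(\<lambda>n. wt p (Suc n) * (1 / (z + period (Suc n) / of_nat p) ^ (2 * m) + 1 / (z - period (Suc n) / of_nat p) ^ (2 * m)))
    sums ((of_nat p - 1) / z ^ (2 * m) - of_nat p / fact (2 * m - 1) * chi_exp_sum p (2 * m - 1) z)"
proof -
  define P :: complex where "P = of_nat p"
  define j where "j = 2 * m - 1"
  define V where "V = power_exp_sum j"
  define f where "f = (\<lambda>n. 1 / (z + period n / P) ^ (2 * m) + 1 / (z - period n / P) ^ (2 * m))"
  have j: "Suc j = 2 * m" "j \<ge> 1" using assms(3) by (auto simp: j_def)
  have P: "P \<noteq> 0" using assms by (simp add: P_def)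
  have "Re (P * z) > 0" using assms by (simp add: P_def)
  from lipschitz_sums[OF this j(2)]
  have "(\<lambda>n. P ^ (2 * m) * (1 / (P * z + period (Suc n)) ^ (2 * m) + 1 / (P * z - period (Suc n)) ^ (2 * m)))
          sums (P ^ (2 * m) * (V (P * z) / fact j - 1 / (P * z) ^ (2 * m)))"
    unfolding j V_def power_exp_sum_def by (rule sums_mult)
  moreover have "P ^ (2 * m) * (1 / (P * z + c) ^ (2 * m) + 1 / (P * z - c) ^ (2 * m)) = 1 / (z + c / P) ^ (2 * m) + 1 / (z - c / P) ^ (2 * m)" for c
  proof -
    have c: "P * z + c = P * (z + c / P)" "P * z - c = P * (z - c / P)"
      using P by (simp_all add: algebra_simps)
    have "P ^ (2 * m) * (1 / (P * x) ^ (2 * m)) = 1 / x ^ (2 * m)" for x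
      using P by (simp add: power_mult_distrib)
    then show ?thesis
      by (subst distrib_left) (simp only: c)
  qed
  ultimately have 1: "(\<lambda>n. f (Suc n)) sums (P ^ (2 * m) * (V (P * z) / fact j - 1 / (P * z) ^ (2 * m)))"
    by (simp only: f_def)
  have "period (p * n) / P = period n" for n
    using P by (simp add: P_def)
  then have "f (p * Suc n) = 1 / (z + period (Suc n)) ^ (2 * m) + 1 / (z - period (Suc n)) ^ (2 * m)" for n
    by (simp only: f_def)
  then have 2: "(\<lambda>n. f (p * Suc n)) sums (V z / fact j - 1 / z ^ (2 * m))"
    using lipschitz_sums[OF assms(1) j(2)] by (simp only: j V_def power_exp_sum_def)
  have T: "chi_exp_sum p j z = V z - P ^ j * V (P * z)"
    using chi_exp_sum_eq[OF assms(1,2), of j] unfolding chi_exp_sum_def V_def P_def by (simp only: sums_iff)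
  have "P ^ (2 * m) * (V (P * z) / fact j - 1 / (P * z) ^ (2 * m)) - P * (V z / fact j - 1 / z ^ (2 * m))
      = (P - 1) / z ^ (2 * m) - P / fact j * chi_exp_sum p j z"
  proof -
    have "P ^ (2 * m) * (x / f - 1 / (P * z) ^ (2 * m)) - P * (y / f - 1 / Z) = (P - 1) / Z - P / f * (y - P ^ j * x)"
      if "Z = z ^ (2 * m)" for x y f Z :: complex
    proof -
      have "P ^ (2 * m) * (1 / (P * z) ^ (2 * m)) = 1 / Z"
        unfolding that using P by (simp add: power_mult_distrib)
      moreover have "P ^ (2 * m) = P * P ^ j"
        unfolding j(1)[symmetric] by simp
      ultimately show ?thesis
        by (simp add: right_diff_distrib diff_divide_distrib)
    qed
    then show ?thesis unfolding T by blast
  qed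
  with sums_wt[OF 1 2 assms(2)] show ?thesis
    by (simp only: f_def P_def j_def)
qed

text \<open>Put \<open>z = 2 w * (L w)\<close>. By \<open>w * v = pi / p\<close> the shifts
  \<open>2 pi i n / p\<close> equal \<open>2 w * (i n v)\<close>, so the factor \<open>2 w\<close>
  can be taken out of every fraction.\<close>

lemma wt_lattice_pair_sums:
  assumes "w > 0" "v > 0" "w * v = pi / real p" "p > 0" "m \<ge> 1" "L > 0"
  shows "(\<lambda>n. wt p (Suc n) * lattice_pair m w v L (real (Suc n))) sums
    ((of_nat p - 1) / of_real (L * w) ^ (2 * m)
      - of_real (2 * w) ^ (2 * m) * (of_nat p / fact (2 * m - 1)) * chi_exp_sum p (2 * m - 1) (of_real (2 * L * w\<^sup>2)))"
proof -
  define z :: complex where "z = of_real (2 * L * w\<^sup>2)"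
  define W :: complex where "W = of_real (2 * w)"
  define X :: complex where "X = of_real (L * w)"
  have W: "W \<noteq> 0" using assms by (simp add: W_def)
  have z: "Re z > 0" "z = W * X"
    using assms by (simp_all add: z_def W_def X_def power2_eq_square)
  have c: "period n / of_nat p = W * (\<i> * of_real (real n * v))" for n
  proof -
    have "period n / of_nat p = 2 * \<i> * of_nat n * of_real (pi / real p)"
      by simp
    also have "\<dots> = W * (\<i> * of_real (real n * v))"
      unfolding assms(3)[symmetric] W_def by simp
    finally show ?thesis .
  qed
  have eq: "W ^ (2 * m) * (1 / (z + period n / of_nat p) ^ (2 * m) + 1 / (z - period n / of_nat p) ^ (2 * m)) = lattice_pair m w v L (real n)" for n
  proof -
    have "W ^ (2 * m) * (1 / (W * x) ^ (2 * m) + 1 / (W * y) ^ (2 * m)) = 1 / x ^ (2 * m) + 1 / y ^ (2 * m)" for x y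
      using W by (simp add: power_mult_distrib distrib_left)
    then show ?thesis
      unfolding lattice_pair_def X_def[symmetric] z(2) c distrib_left[of W X, symmetric] right_diff_distrib[of W X, symmetric] .
  qed
  have "(\<lambda>n. W ^ (2 * m) * (wt p (Suc n) * (1 / (z + period (Suc n) / of_nat p) ^ (2 * m) + 1 / (z - period (Suc n) / of_nat p) ^ (2 * m))))
    sums (W ^ (2 * m) * ((of_nat p - 1) / z ^ (2 * m) - of_nat p / fact (2 * m - 1) * chi_exp_sum p (2 * m - 1) z))"
    by (intro sums_mult wt_lipschitz_sums assms z)
  moreover have "W ^ (2 * m) * (wt p (Suc n) * (1 / (z + period (Suc n) / of_nat p) ^ (2 * m) + 1 / (z - period (Suc n) / of_nat p) ^ (2 * m)))
      = wt p (Suc n) * lattice_pair m w v L (real (Suc n))" for n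
    unfolding eq[symmetric] by (rule mult.left_commute)
  moreover have "W ^ (2 * m) * ((of_nat p - 1) / z ^ (2 * m) - of_nat p / fact (2 * m - 1) * chi_exp_sum p (2 * m - 1) z)
     = (of_nat p - 1) / X ^ (2 * m) - W ^ (2 * m) * (of_nat p / fact (2 * m - 1)) * chi_exp_sum p (2 * m - 1) z"
    unfolding right_diff_distrib z(2) power_mult_distrib using W by simp
  ultimately show ?thesis
    by (simp only: W_def X_def z_def)
qed

text \<open>Exchange of summation when only the sums over blocks of \<open>p\<close> consecutive
  \<open>n\<close> are absolutely summable. Fubini applies to the blocks, and grouping does not
  change the limits of series already known to converge.\<close>

lemma grouped_sums_exchange:
  fixes G :: "nat \<Rightarrow> nat \<Rightarrow> complex"
  assumes "\<And>l. G l sums r l" "r sums S" "\<And>n. (\<lambda>l. G l n) sums c n" "c sums T" "p > 0"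
    and "\<And>l q. norm (\<Sum>n = q * p..<q * p + p. G l n) \<le> u l * v q"
    and "summable u" "summable v" "\<And>l. u l \<ge> 0" "\<And>q. v q \<ge> 0"
  shows "S = T"
proof -
  define g where "g = (\<lambda>l q. \<Sum>n = q * p..<q * p + p. G l n)"
  note g = summable_on_double_sums[OF summable_on_double_comparison[of g u v]]
  have "(\<Sum>q. g l q) = r l" for l
    using sums_group[OF assms(1,5)] unfolding g_def by (simp only: sums_iff)
  then have "r sums infsum (\<lambda>(l, q). g l q) UNIV"
    using g(3) assms by (simp add: g_def)
  moreover have "(\<Sum>l. g l q) = (\<Sum>n = q * p..<q * p + p. c n)" for q
    using sums_sum[of "{q * p..<q * p + p}" "\<lambda>n l. G l n" c] assms(3) unfolding g_def by (simp add: sums_iff)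
  then have "(\<lambda>q. \<Sum>n = q * p..<q * p + p. c n) sums infsum (\<lambda>(l, q). g l q) UNIV"
    using g(4) assms by (simp add: g_def)
  ultimately show ?thesis
    using sums_group[OF assms(4,5)] assms(2) sums_unique2 by metis
qed

text \<open>Scaling by \<open>s\<close> moves both inverses into the closed unit disc, where the
  difference of \<open>M\<close>-th powers is at most \<open>M\<close> times the difference of the
  bases.\<close>

lemma norm_inverse_power_diff_le:
  fixes X Y :: complex
  assumes "norm X \<ge> 1 / s" "norm Y \<ge> 1 / s" "s > 0" "norm (X - Y) \<le> \<delta>"
  shows "norm (1 / X ^ M - 1 / Y ^ M) \<le> real M * \<delta> * s ^ Suc M"
proof -
  have nz: "norm X > 0" "norm Y > 0"
    using assms less_le_trans[of 0 "1 / s"] by auto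
  then have XY: "X \<noteq> 0" "Y \<noteq> 0" by auto
  define x y where "x = 1 / (of_real s * X)" and "y = 1 / (of_real s * Y)"
  have n1: "norm x \<le> 1" "norm y \<le> 1"
    using assms nz by (simp_all add: x_def y_def norm_divide norm_mult field_simps)
  have le: "1 / norm X \<le> s" "1 / norm Y \<le> s"
    using assms nz by (simp_all add: field_simps)
  have xy: "norm (x - y) \<le> \<delta> * s"
  proof -
    have "x - y = (Y - X) / (of_real s * X * Y)"
      using XY assms by (simp add: x_def y_def field_simps)
    then have "norm (x - y) = norm (X - Y) * (1 / norm X) * (1 / norm Y) / s"
      using assms by (simp add: norm_divide norm_mult norm_minus_commute)
    also have "\<dots> \<le> \<delta> * s * s / s"
      using assms nz order.trans[OF norm_ge_zero assms(4)]
      by (intro divide_right_mono mult_mono le mult_nonneg_nonneg) auto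
    finally show ?thesis using assms by simp
  qed
  have "1 / X ^ M - 1 / Y ^ M = of_real (s ^ M) * (x ^ M - y ^ M)"
    using assms by (simp add: x_def y_def power_divide power_mult_distrib right_diff_distrib)
  then have "norm (1 / X ^ M - 1 / Y ^ M) = s ^ M * norm (x ^ M - y ^ M)"
    using assms by (simp only: norm_mult norm_of_real) simp
  also have "\<dots> \<le> s ^ M * (real M * norm (x - y))"
    using assms n1 by (intro mult_left_mono norm_power_diff) auto
  also have "\<dots> \<le> s ^ M * (real M * (\<delta> * s))"
    using assms xy by (intro mult_left_mono) auto
  finally show ?thesis
    by (simp add: mult_ac)
qed

text \<open>The squared modulus \<open>(L w)^2 + (N v)^2\<close> is at least \<open>L w N v\<close>,
  a bound in product form. Taking a difference gains one power of the inverse modulus, from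
  \<open>2 m\<close> to \<open>2 m + 1\<close>.\<close>

lemma lattice_pair_diff_le:
  assumes "w > 0" "v > 0" "L > 0" "Q > 0" "N \<ge> Q" "N' \<ge> Q" "\<bar>N - N'\<bar> \<le> K"
  shows "norm (lattice_pair m w v L N - lattice_pair m w v L N')
     \<le> 2 * (real (2 * m) * (K * v) * (1 / (sqrt (w * v) * (sqrt L * sqrt Q))) ^ Suc (2 * m))"
proof -
  define s where "s = 1 / (sqrt (w * v) * (sqrt L * sqrt Q))"
  have s: "s > 0" using assms by (simp add: s_def)
  have lower: "1 / s \<le> norm (of_real (L * w) + \<i> * of_real (x * v))" if "\<bar>x\<bar> \<ge> Q" for x
  proof -
    have "(1 / s)\<^sup>2 = L * w * (Q * v)"
      using assms by (simp add: s_def power_mult_distrib)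
    also have "\<dots> \<le> L * w * (\<bar>x\<bar> * v)"
      using assms that by (intro mult_left_mono mult_right_mono) auto
    also have "\<dots> \<le> (L * w)\<^sup>2 + (\<bar>x\<bar> * v)\<^sup>2"
    proof -
      have "0 \<le> L * w * (\<bar>x\<bar> * v)"
        using assms by (intro mult_nonneg_nonneg) auto
      then show ?thesis
        using sum_squares_bound[of "L * w" "\<bar>x\<bar> * v"] by linarith
    qed
    also have "\<dots> = (norm (of_real (L * w) + \<i> * of_real (x * v)))\<^sup>2"
      by (simp add: cmod_power2 power_mult_distrib)
    finally show ?thesis
      by (rule power2_le_imp_le) simp
  qed
  have diff: "norm (1 / (of_real (L * w) + \<i> * of_real (x * v)) ^ (2 * m) - 1 / (of_real (L * w) + \<i> * of_real (y * v)) ^ (2 * m))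
     \<le> real (2 * m) * (K * v) * s ^ Suc (2 * m)" if "\<bar>x\<bar> \<ge> Q" "\<bar>y\<bar> \<ge> Q" "\<bar>x - y\<bar> \<le> K" for x y
  proof (rule norm_inverse_power_diff_le[OF lower lower s])
    have "of_real (L * w) + \<i> * of_real (x * v) - (of_real (L * w) + \<i> * of_real (y * v)) = \<i> * of_real ((x - y) * v)"
      by (simp add: algebra_simps)
    then have "norm (of_real (L * w) + \<i> * of_real (x * v) - (of_real (L * w) + \<i> * of_real (y * v))) = \<bar>x - y\<bar> * v"
      using assms(2) by (simp add: norm_mult abs_mult del: of_real_mult of_real_diff)
    also have "\<dots> \<le> K * v"
      using assms that by (intro mult_right_mono) auto
    finally show "norm (of_real (L * w) + \<i> * of_real (x * v) - (of_real (L * w) + \<i> * of_real (y * v))) \<le> K * v" .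
  qed (use that in auto)
  define F where "F = (\<lambda>x. 1 / (of_real (L * w) + \<i> * of_real (x * v)) ^ (2 * m) :: complex)"
  have "lattice_pair m w v L x = F x + F (- x)" for x
    by (simp add: lattice_pair_def F_def)
  then have "norm (lattice_pair m w v L N - lattice_pair m w v L N') = norm ((F N - F N') + (F (- N) - F (- N')))"
    by (simp add: algebra_simps)
  also have "\<dots> \<le> norm (F N - F N') + norm (F (- N) - F (- N'))"
    by (rule norm_triangle_ineq)
  also have "\<dots> \<le> real (2 * m) * (K * v) * s ^ Suc (2 * m) + real (2 * m) * (K * v) * s ^ Suc (2 * m)"
    unfolding F_def by (intro add_mono diff) (use assms in auto)
  finally show ?thesis
    by (simp only: s_def mult_2)
qed

text \<open>Of \<open>p\<close> consecutive integers exactly one is a multiple of \<open>p\<close>: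
  its weight \<open>1 - p\<close> balances the \<open>p - 1\<close> weights 1.\<close>

lemma sum_wt_block:
  assumes "p > 0"
  shows "(\<Sum>n = q * p..<q * p + p. wt p (Suc n)) = 0"
proof -
  have *: "wt p (Suc n) = wt p (Suc (n - q * p))" if "n \<ge> q * p" for n
  proof -
    have "Suc n = q * p + Suc (n - q * p)" using that by simp
    then show ?thesis
      unfolding wt_def by (metis dvd_add_right_iff dvd_triv_right)
  qed
  have "(\<Sum>n = q * p..<q * p + p. wt p (Suc n)) = (\<Sum>r<p. wt p (Suc r))"
    by (rule sum.reindex_bij_witness[of _ "\<lambda>r. q * p + r" "\<lambda>n. n - q * p"])
       (auto simp: *)
  also have "\<dots> = (\<Sum>r<p. 1 - (if r = p - 1 then of_nat p else 0))"
  proof (rule sum.cong)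
    fix r assume "r \<in> {..<p}"
    then have "p dvd Suc r \<longleftrightarrow> r = p - 1"
      using assms by (auto dest: dvd_imp_le)
    then show "wt p (Suc r) = 1 - (if r = p - 1 then of_nat p else 0)"
      by (simp add: wt_def)
  qed simp
  also have "\<dots> = 0"
    unfolding sum_subtractf using assms by simp
  finally show ?thesis .
qed


lemma summable_inverse_sqrt_cube: "summable (\<lambda>n. (1 / sqrt (real (Suc n))) ^ 3)"
proof -
  have "(1 / sqrt (real (Suc n))) ^ 3 = real (Suc n) powr (- (3 / 2))" for n
  proof -
    have "(1 / sqrt (real (Suc n))) = real (Suc n) powr (- (1 / 2))"
      by (simp add: powr_minus powr_half_sqrt inverse_eq_divide del: of_nat_Suc)
    then have "(1 / sqrt (real (Suc n))) ^ 3 = (real (Suc n) powr (- (1 / 2))) powr real 3"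
      by (subst powr_realpow) (simp_all del: of_nat_Suc)
    then show ?thesis
      by (simp add: powr_powr del: of_nat_Suc)
  qed
  moreover have "summable (\<lambda>n. real (Suc n) powr (- (3 / 2)))"
    by (subst summable_Suc_iff, subst summable_real_powr_iff) simp
  ultimately show ?thesis by (simp only:)
qed

text \<open>The weights of a block add up to zero, so the value at its first point \<open>N0\<close>
  can be subtracted from every term. The differences carry the exponent
  \<open>(2m + 1) / 2 \<ge> 3 / 2\<close> in each variable, which is summable even for
  \<open>m = 1\<close>.\<close>

lemma lattice_block_bound:
  assumes "w > 0" "v > 0" "p > 0" "m \<ge> 1"
  shows "norm (\<Sum>n = q * p..<q * p + p. wt p (Suc l) * (wt p (Suc n) * lattice_pair m w v (real (Suc l)) (real (Suc n))))
     \<le> (real p * ((1 + real p) * ((1 + real p) * (2 * (real (2 * m) * (real p * v) * (1 / sqrt (w * v)) ^ Suc (2 * m)))))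
           * (1 / sqrt (real (Suc l))) ^ 3) * (1 / sqrt (real (Suc q))) ^ 3"
proof -
  define L Q where "L = real (Suc l)" and "Q = real (Suc q)"
  have LQ: "L \<ge> 1" "Q \<ge> 1" by (simp_all add: L_def Q_def)
  define c where "c = 2 * (real (2 * m) * (real p * v) * (1 / sqrt (w * v)) ^ Suc (2 * m))"
  have c: "c \<ge> 0" using assms by (simp add: c_def)
  define t where "t = (1 / sqrt L) * (1 / sqrt Q)"
  have t: "0 \<le> t" "t \<le> 1"
    using LQ mult_le_one[of "1 / sqrt L" "1 / sqrt Q"] by (simp_all add: t_def)
  define N0 where "N0 = real (Suc (q * p))"
  define \<Phi> where "\<Phi> = (\<lambda>N. lattice_pair m w v L N)"
  have d: "norm (\<Phi> (real (Suc n)) - \<Phi> N0) \<le> c * t ^ 3" if n: "n \<in> {q * p..<q * p + p}" for n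
  proof -
    \<comment> \<open>Block \<open>q\<close> starts at index \<open>q * p \<ge> q\<close>, so
      \<open>Q = q + 1\<close> is a lower bound for all its points.\<close>
    have "q * 1 \<le> q * p" using assms by (intro mult_left_mono) auto
    then have qp: "q \<le> q * p" by simp
    have "q * p \<le> n" using n by simp
    with qp have qn: "q \<le> n" by (rule order.trans)
    have "norm (\<Phi> (real (Suc n)) - \<Phi> N0)
        \<le> 2 * (real (2 * m) * (real p * v) * (1 / (sqrt (w * v) * (sqrt L * sqrt Q))) ^ Suc (2 * m))"
      unfolding \<Phi>_def
    proof (rule lattice_pair_diff_le)
      show "Q \<le> real (Suc n)" "Q \<le> N0"
        unfolding Q_def N0_def of_nat_le_iff Suc_le_mono by (fact qn, fact qp)
      show "\<bar>real (Suc n) - N0\<bar> \<le> real p"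
        using n unfolding N0_def by (auto simp del: of_nat_mult)
    qed (use assms LQ in auto)
    also have "\<dots> = c * t ^ Suc (2 * m)"
    proof -
      have "1 / (sqrt (w * v) * (sqrt L * sqrt Q)) = (1 / sqrt (w * v)) * t"
        by (simp only: t_def times_divide_times_eq mult_1)
      then show ?thesis
        by (simp only: power_mult_distrib c_def mult.assoc)
    qed
    also have "\<dots> \<le> c * t ^ 3"
      using c t assms by (intro mult_left_mono power_decreasing) auto
    finally show ?thesis .
  qed
  have "(\<Sum>n = q * p..<q * p + p. wt p (Suc l) * (wt p (Suc n) * \<Phi> (real (Suc n))))
      = (\<Sum>n = q * p..<q * p + p. wt p (Suc l) * (wt p (Suc n) * (\<Phi> (real (Suc n)) - \<Phi> N0)))"
  proof -
    have "(\<Sum>n = q * p..<q * p + p. wt p (Suc l) * (wt p (Suc n) * (\<Phi> (real (Suc n)) - \<Phi> N0)))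
       = (\<Sum>n = q * p..<q * p + p. wt p (Suc l) * (wt p (Suc n) * \<Phi> (real (Suc n))))
        - wt p (Suc l) * ((\<Sum>n = q * p..<q * p + p. wt p (Suc n)) * \<Phi> N0)"
      by (simp only: right_diff_distrib sum_subtractf sum_distrib_left sum_distrib_right)
    then show ?thesis
      unfolding sum_wt_block[OF assms(3)] by simp
  qed
  also have "norm \<dots> \<le> real (card {q * p..<q * p + p}) * ((1 + real p) * ((1 + real p) * (c * t ^ 3)))"
  proof (rule sum_norm_bound)
    fix n assume "n \<in> {q * p..<q * p + p}"
    then show "norm (wt p (Suc l) * (wt p (Suc n) * (\<Phi> (real (Suc n)) - \<Phi> N0))) \<le> (1 + real p) * ((1 + real p) * (c * t ^ 3))"
      unfolding norm_mult by (intro mult_mono norm_wt_le d mult_nonneg_nonneg) auto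
  qed
  also have "\<dots> = (real p * ((1 + real p) * ((1 + real p) * c)) * (1 / sqrt L) ^ 3) * (1 / sqrt Q) ^ 3"
    unfolding t_def power_mult_distrib by simp
  finally show ?thesis
    unfolding \<Phi>_def c_def L_def Q_def .
qed

lemma wt_zeta_sums:
  assumes "p > 0" "m \<ge> 1"
  shows "(\<lambda>l. wt p (Suc l) * (1 / of_nat (Suc l) ^ (2 * m))) sums ((1 - of_nat p / of_nat p ^ (2 * m)) * zeta_nat (2 * m))"
proof -
  have s: "(\<lambda>n. 1 / of_nat (Suc n) ^ (2 * m)) sums zeta_nat (2 * m)"
    using assms by (intro zeta_nat_sums) simp
  have "1 / of_nat (p * Suc n) ^ (2 * m) = (1 / of_nat p ^ (2 * m) * (1 / of_nat (Suc n) ^ (2 * m)) :: complex)" for n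
    unfolding of_nat_mult power_mult_distrib times_divide_times_eq mult_1 ..
  then have "(\<lambda>n. 1 / of_nat (p * Suc n) ^ (2 * m)) sums (1 / of_nat p ^ (2 * m) * zeta_nat (2 * m))"
    using sums_mult[OF s] by (simp only:)
  from sums_wt[OF s this assms(1)] show ?thesis
    by (simp add: left_diff_distrib)
qed

text \<open>Adds up the row sums of the lattice series. The first part is a weighted zeta value; the
  second is the Lambert series summed by columns, since division by the power \<open>1 - 2 m\<close>
  is multiplication by the power \<open>2 m - 1\<close>.\<close>

lemma lambert_negative_sums:
  assumes "w > 0" "p > 0" "m \<ge> 1"
  shows "(\<lambda>l. wt p (Suc l) * ((of_nat p - 1) / of_real (real (Suc l) * w) ^ (2 * m)
            - of_real (2 * w) ^ (2 * m) * (of_nat p / fact (2 * m - 1)) * chi_exp_sum p (2 * m - 1) (of_real (2 * real (Suc l) * w\<^sup>2))))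
     sums ((of_nat p - 1) * ((1 - of_nat p / of_nat p ^ (2 * m)) * zeta_nat (2 * m)) / of_real w ^ (2 * m)
            - of_real (2 * w) ^ (2 * m) * (of_nat p / fact (2 * m - 1)) * infsum (\<lambda>(d, l). lambert_term p (1 - 2 * int m) (w\<^sup>2) d l) UNIV)"
proof -
  define C :: complex where "C = of_real (2 * w) ^ (2 * m) * (of_nat p / fact (2 * m - 1))"
  define T where "T = (\<lambda>l. chi_exp_sum p (2 * m - 1) (of_real (2 * real (Suc l) * w\<^sup>2)))"
  have "(\<Sum>d. lambert_term p (1 - 2 * int m) (w\<^sup>2) d l) = wt p (Suc l) * T l" for l
  proof -
    define z :: complex where "z = of_real (2 * real (Suc l) * w\<^sup>2)"
    have z: "Re z > 0" using assms by (simp add: z_def del: of_nat_Suc)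
    have "lambert_term p (1 - 2 * int m) (w\<^sup>2) d l = wt p (Suc l) * (chi p (Suc d) * (of_nat (Suc d) ^ (2 * m - 1) * exp (- of_nat (Suc d) * z)))" for d
    proof -
      have "1 - 2 * int m = - int (2 * m - 1)" using assms by simp
      then have "1 / of_nat (Suc d) powi (1 - 2 * int m) = (of_nat (Suc d) ^ (2 * m - 1) :: complex)"
        by (simp only: power_int_minus power_int_of_nat inverse_eq_divide div_by_1 divide_divide_eq_right mult_1)
      then have "x / of_nat (Suc d) powi (1 - 2 * int m) = x * (of_nat (Suc d) ^ (2 * m - 1) :: complex)" for x
        by (metis times_divide_eq_right mult_1_right)
      moreover have "complex_of_real (exp (- 2 * real (Suc d * Suc l) * w\<^sup>2)) = exp (- of_nat (Suc d) * z)"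
        unfolding exp_of_real[symmetric] by (rule arg_cong[where f = exp]) (simp add: z_def algebra_simps)
      ultimately show ?thesis
        unfolding lambert_term_def by (simp only: mult_ac)
    qed
    moreover have "(\<lambda>d. wt p (Suc l) * (chi p (Suc d) * (of_nat (Suc d) ^ (2 * m - 1) * exp (- of_nat (Suc d) * z)))) sums (wt p (Suc l) * T l)"
      unfolding T_def z_def[symmetric] chi_exp_sum_def
      by (intro sums_mult summable_sums sums_summable[OF chi_exp_sum_eq[OF z assms(2)]])
    ultimately show ?thesis
      by (simp only: sums_iff)
  qed
  then have S: "(\<lambda>l. wt p (Suc l) * T l) sums infsum (\<lambda>(d, l). lambert_term p (1 - 2 * int m) (w\<^sup>2) d l) UNIV"
    using summable_on_double_sums(4)[OF lambert_summable[of "w\<^sup>2" p "1 - 2 * int m"]] assms by simp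
  have "(\<lambda>l. (of_nat p - 1) / of_real w ^ (2 * m) * (wt p (Suc l) * (1 / of_nat (Suc l) ^ (2 * m))) - C * (wt p (Suc l) * T l))
    sums ((of_nat p - 1) / of_real w ^ (2 * m) * ((1 - of_nat p / of_nat p ^ (2 * m)) * zeta_nat (2 * m)) - C * infsum (\<lambda>(d, l). lambert_term p (1 - 2 * int m) (w\<^sup>2) d l) UNIV)"
    by (intro sums_diff sums_mult wt_zeta_sums S assms)
  moreover have "(of_nat p - 1) / of_real w ^ (2 * m) * (wt p (Suc l) * (1 / of_nat (Suc l) ^ (2 * m))) - C * (wt p (Suc l) * T l)
     = wt p (Suc l) * ((of_nat p - 1) / of_real (real (Suc l) * w) ^ (2 * m) - C * T l)" for l
  proof -
    have "(of_nat p - 1) / of_real w ^ (2 * m) * (1 / of_nat (Suc l) ^ (2 * m)) = (of_nat p - 1) / (of_real (real (Suc l) * w) ^ (2 * m) :: complex)"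
      unfolding of_real_mult of_real_of_nat_eq power_mult_distrib times_divide_times_eq by (simp only: mult_1_right mult_1 mult.commute)
    then show ?thesis
      unfolding right_diff_distrib by (metis mult.left_commute)
  qed
  ultimately show ?thesis
    by (simp only: C_def T_def times_divide_eq_left)
qed

text \<open>Both sides are iterated sums of the same weighted lattice series, over \<open>n\<close>
  first on the left and over \<open>l\<close> first on the right. The second order exchanges
  \<open>w\<close> with \<open>v\<close> and brings the sign of
  \<open>lattice_pair_swap\<close>.\<close>

lemma lambert_negative_transformation:
  assumes "w > 0" "v > 0" "w * v = pi / real p" "p > 0" "m \<ge> 1"
  defines "S \<equiv> \<lambda>\<alpha>. infsum (\<lambda>(d, l). lambert_term p (1 - 2 * int m) \<alpha> d l) UNIV"
    and "Z \<equiv> (1 - of_nat p / of_nat p ^ (2 * m)) * zeta_nat (2 * m)"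
    and "C \<equiv> of_nat p / fact (2 * m - 1)"
  shows "(of_nat p - 1) * Z / of_real w ^ (2 * m) - of_real (2 * w) ^ (2 * m) * C * S (w\<^sup>2)
     = (-1) ^ m * ((of_nat p - 1) * Z / of_real v ^ (2 * m) - of_real (2 * v) ^ (2 * m) * C * S (v\<^sup>2))"
proof -
  define r where "r = (\<lambda>w l. (of_nat p - 1) / of_real (real (Suc l) * w) ^ (2 * m)
            - of_real (2 * w) ^ (2 * m) * (of_nat p / fact (2 * m - 1)) * chi_exp_sum p (2 * m - 1) (of_real (2 * real (Suc l) * w\<^sup>2)))"
  define G where "G = (\<lambda>l n. wt p (Suc l) * (wt p (Suc n) * lattice_pair m w v (real (Suc l)) (real (Suc n))))"
  show ?thesis
  proof (rule grouped_sums_exchange[OF _ _ _ _ assms(4)])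
    show "G l sums (wt p (Suc l) * r w l)" for l
      unfolding G_def r_def by (intro sums_mult wt_lattice_pair_sums assms) simp
    show "(\<lambda>l. wt p (Suc l) * r w l) sums ((of_nat p - 1) * Z / of_real w ^ (2 * m) - of_real (2 * w) ^ (2 * m) * C * S (w\<^sup>2))"
      unfolding r_def S_def Z_def C_def by (intro lambert_negative_sums assms)
    show "(\<lambda>l. G l n) sums ((-1) ^ m * (wt p (Suc n) * r v n))" for n
    proof -
      have "v * w = pi / real p" using assms(3) by (simp only: mult.commute)
      then have "(\<lambda>l. (-1) ^ m * (wt p (Suc n) * (wt p (Suc l) * lattice_pair m v w (real (Suc n)) (real (Suc l))))) sums ((-1) ^ m * (wt p (Suc n) * r v n))"
        unfolding r_def by (intro sums_mult wt_lattice_pair_sums assms) simp_all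
      moreover have "(-1) ^ m * (wt p (Suc n) * (wt p (Suc l) * lattice_pair m v w (real (Suc n)) (real (Suc l)))) = G l n" for l
        unfolding G_def lattice_pair_swap[of m w v "real (Suc l)" "real (Suc n)"] by (simp only: mult_ac)
      ultimately show ?thesis by (simp only:)
    qed
    show "(\<lambda>n. (-1) ^ m * (wt p (Suc n) * r v n)) sums ((-1) ^ m * ((of_nat p - 1) * Z / of_real v ^ (2 * m) - of_real (2 * v) ^ (2 * m) * C * S (v\<^sup>2)))"
      unfolding r_def S_def Z_def C_def by (intro sums_mult lambert_negative_sums assms)
    show "norm (\<Sum>n = q * p..<q * p + p. G l n)
      \<le> (real p * ((1 + real p) * ((1 + real p) * (2 * (real (2 * m) * (real p * v) * (1 / sqrt (w * v)) ^ Suc (2 * m)))))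
           * (1 / sqrt (real (Suc l))) ^ 3) * (1 / sqrt (real (Suc q))) ^ 3" for l q
      unfolding G_def by (intro lattice_block_bound assms)
    show "summable (\<lambda>q. (1 / sqrt (real (Suc q))) ^ 3)"
      by (rule summable_inverse_sqrt_cube)
    show "summable (\<lambda>l. real p * ((1 + real p) * ((1 + real p) * (2 * (real (2 * m) * (real p * v) * (1 / sqrt (w * v)) ^ Suc (2 * m)))))
           * (1 / sqrt (real (Suc l))) ^ 3)"
      by (rule summable_mult[OF summable_inverse_sqrt_cube])
  qed (use assms in simp_all)
qed

lemma L_fun_negative:
  assumes "p > 0" "m \<ge> 1"
  shows "L_fun p (of_int (1 - 2 * int m)) = - ((1 - of_nat p ^ (2 * m - 1)) * of_real (bernoulli (2 * m)) / of_nat (2 * m))"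
proof -
  define s :: complex where "s = of_int (1 - 2 * int m)"
  have s: "s = 1 - of_nat (2 * m)" "s - 1 = - of_nat (2 * m)" "- s = of_nat (2 * m - 1)"
    using assms by (simp_all add: s_def of_nat_diff)
  have "of_nat p powr (- s) = of_nat p ^ (2 * m - 1)"
    unfolding s(3) by (rule powr_nat') (use assms in auto)
  moreover have "entire_zeta s = of_real (bernoulli (2 * m))"
    unfolding s(1) entire_zeta_nonpos_int by simp
  ultimately show ?thesis
    unfolding L_fun_def s_def[symmetric] by (simp only: s(2) divide_minus_right)
qed

text \<open>The previous identity with \<open>w\<close> and \<open>v\<close> the square roots of
  \<open>\<alpha>\<close> and \<open>\<beta>\<close>. It remains to express the boundary terms
  \<open>Z\<close> by the L-value at \<open>1 - 2 m\<close>.\<close>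

lemma lambert_transformation_negative:
  assumes "\<alpha> > 0" "\<beta> > 0" "\<alpha> * \<beta> = pi\<^sup>2 / (real p)\<^sup>2" "p > 0" "m \<ge> 1"
  defines "S \<equiv> \<lambda>\<alpha>. infsum (\<lambda>(d, l). lambert_term p (1 - 2 * int m) \<alpha> d l) UNIV"
    and "L \<equiv> L_fun p (of_int (1 - 2 * int m))"
  shows "(4 * of_real \<alpha>) ^ m * ((of_nat p - 1) / 2 * L - S \<alpha>) - (- 4 * of_real \<beta>) ^ m * ((of_nat p - 1) / 2 * L - S \<beta>) = 0"
proof -
  define Z :: complex where "Z = (1 - of_nat p / of_nat p ^ (2 * m)) * zeta_nat (2 * m)"
  define C :: complex where "C = of_nat p / fact (2 * m - 1)"
  define a b f g P :: complex where "a = of_real \<alpha> ^ m" and "b = of_real \<beta> ^ m" and "f = 4 ^ m" and "g = (-1) ^ m" and "P = of_nat p"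
  have nz: "a \<noteq> 0" "b \<noteq> 0" "C \<noteq> 0" "P \<noteq> 0"
    using assms by (simp_all add: a_def b_def C_def P_def)
  have gg: "g * g = 1"
    by (simp add: g_def flip: power_mult_distrib)
  have w: "sqrt \<alpha> > 0" "sqrt \<beta> > 0" "sqrt \<alpha> * sqrt \<beta> = pi / real p"
    using assms by (simp_all add: real_sqrt_divide flip: real_sqrt_mult)
  have pw: "of_real (sqrt x) ^ (2 * m) = (of_real x ^ m :: complex)" "of_real (2 * sqrt x) ^ (2 * m) = (f * of_real x ^ m :: complex)"
    if "x > 0" for x
  proof -
    have e: "sqrt x ^ (2 * m) = x ^ m" "(2 * sqrt x) ^ (2 * m) = 4 ^ m * x ^ m"
      using that by (simp_all add: power_mult power_mult_distrib)
    show "of_real (sqrt x) ^ (2 * m) = (of_real x ^ m :: complex)" "of_real (2 * sqrt x) ^ (2 * m) = (f * of_real x ^ m :: complex)"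
      unfolding of_real_power[symmetric] e f_def by simp_all
  qed
  have sq: "(sqrt \<alpha>)\<^sup>2 = \<alpha>" "(sqrt \<beta>)\<^sup>2 = \<beta>" using assms by simp_all
  have T: "(P - 1) * Z / a - f * a * C * S \<alpha> = g * ((P - 1) * Z / b - f * b * C * S \<beta>)"
    using lambert_negative_transformation[OF w assms(4,5)]
    unfolding sq pw[OF assms(1)] pw[OF assms(2)] unfolding Z_def C_def a_def b_def g_def P_def S_def .
  \<comment> \<open>The functional equation at this point: \<open>zeta_nat (2 * m)\<close> and
    \<open>L\<close> are both explicit multiples of the same Bernoulli number, and
    \<open>a * b = (pi / p)^(2m)\<close>.\<close>
  have K: "Z = - g * f * L * C * (a * b) / 2"
  proof -
    define B :: complex where "B = of_real (bernoulli (2 * m))"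
    define q :: complex where "q = of_real pi ^ (2 * m)"
    define F :: complex where "F = fact (2 * m)"
    have F: "F = of_nat (2 * m) * fact (2 * m - 1)" "F \<noteq> 0"
      using assms(5) fact_reduce[of "2 * m", where 'a = complex] by (simp_all add: F_def)
    have P: "P ^ (2 * m) = P * P ^ (2 * m - 1)"
      using assms(5) by (simp flip: power_Suc)
    have ab: "a * b = q / P ^ (2 * m)"
    proof -
      have "a * b = of_real ((\<alpha> * \<beta>) ^ m)"
        by (simp add: a_def b_def power_mult_distrib)
      then show ?thesis
        unfolding assms(3) by (simp add: q_def P_def power_divide power_mult)
    qed
    have "(2 * of_real pi) ^ (2 * m) = f * q"
      by (simp add: f_def q_def power_mult power_mult_distrib)
    then have zeta: "zeta_nat (2 * m) = - g * (B / F) * (f * q) / 2"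
      using zeta_nat_even[OF assms(5)] by (simp add: g_def B_def F_def)
    have L: "L = - ((1 - P ^ (2 * m - 1)) * B / of_nat (2 * m))"
      unfolding L_def B_def P_def by (rule L_fun_negative[OF assms(4,5)])
    define M :: complex where "M = of_nat (2 * m)"
    define G :: complex where "G = fact (2 * m - 1)"
    define R where "R = P ^ (2 * m - 1)"
    have nz': "M \<noteq> 0" "G \<noteq> 0" "R \<noteq> 0" "F = M * G"
      using assms F nz by (simp_all add: M_def G_def R_def)
    show ?thesis
      unfolding Z_def zeta L ab C_def M_def[symmetric] G_def[symmetric] R_def[symmetric] P_def[symmetric] P nz'(4)
      using nz' nz(4) by (simp add: field_simps)
  qed
  have 1: "f * a * S \<alpha> - g * f * b * S \<beta> = (P - 1) * Z * (b - g * a) / (a * b * C)"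
  proof -
    have "C * (f * a * S \<alpha> - g * f * b * S \<beta>) = (P - 1) * Z / a - g * ((P - 1) * Z / b)"
      using T by (simp add: algebra_simps)
    also have "\<dots> = (P - 1) * Z * (b - g * a) / (a * b)"
      using nz by (simp add: field_simps)
    finally show ?thesis
      using nz by (simp add: field_simps)
  qed
  \<comment> \<open>Since \<open>g * g = 1\<close>, the factor \<open>- g\<close> contained in
    \<open>Z\<close> turns \<open>b - g * a\<close> into \<open>a - g * b\<close>.\<close>
  have 2: "(P - 1) * Z * (b - g * a) / (a * b * C) = (f * a - g * f * b) * ((P - 1) / 2 * L)"
  proof -
    define h where "h = L / 2"
    have K': "Z = - (g * f * h * C * (a * b))"
      unfolding K h_def by simp
    have "(P - 1) * Z * (b - g * a) = (f * a - g * f * b) * ((P - 1) * h) * (a * b * C)"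
      using K' gg by algebra
    moreover have "(P - 1) * h = (P - 1) / 2 * L"
      by (simp add: h_def)
    ultimately have "(P - 1) * Z * (b - g * a) = (f * a - g * f * b) * ((P - 1) / 2 * L) * (a * b * C)"
      by (simp only:)
    moreover have "a * b * C \<noteq> 0"
      using nz by simp
    ultimately show ?thesis
      by (metis nonzero_mult_div_cancel_right)
  qed
  have "(4 * of_real \<alpha>) ^ m = f * a" "(- 4 * of_real \<beta>) ^ m = g * f * b"
  proof -
    show "(4 * of_real \<alpha>) ^ m = f * a"
      by (simp only: power_mult_distrib f_def a_def)
    have "(- 4 * of_real \<beta>) ^ m = ((-1) * 4 * of_real \<beta> :: complex) ^ m"
      by simp
    then show "(- 4 * of_real \<beta>) ^ m = g * f * b"
      by (simp only: power_mult_distrib f_def b_def g_def)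
  qed
  moreover have "X * (H - s) - Y * (H - t) = 0" if "X * s - Y * t = (X - Y) * H" for X Y H s t :: complex
    using that by (simp add: algebra_simps)
  ultimately show ?thesis
    using trans[OF 1 2] unfolding P_def by (simp only:)
qed

theorem theorem2:
  fixes p :: nat and \<alpha> \<beta> :: real and a :: "nat \<Rightarrow> complex" and k :: int
  assumes "prime p"
    and "\<alpha> > 0" and "\<beta> > 0"
    and "\<alpha> * \<beta> = pi\<^sup>2 / (of_nat p)\<^sup>2"
    and "\<And>n. n \<ge> 1 \<Longrightarrow> gcd n p = 1 \<Longrightarrow> a n = 1"
    and "\<And>n. n \<ge> 1 \<Longrightarrow> p dvd n \<Longrightarrow> a n = 1 - of_nat p"
    and "k \<noteq> 0"
  shows
    "(4 * of_real \<alpha>) powi (-k) *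
       ((of_nat p - 1) / 2 * dirichlet_L (of_int (2 * k + 1)) (principal_dchar p) -
        (\<Sum>n. a (Suc n) *
           (\<Sum>d | d dvd Suc n. principal_dchar p d / of_nat d powi (2 * k + 1)) *
           of_real (exp (- 2 * of_nat (Suc n) * \<alpha>)))) -
     (- 4 * of_real \<beta>) powi (-k) *
       ((of_nat p - 1) / 2 * dirichlet_L (of_int (2 * k + 1)) (principal_dchar p) -
        (\<Sum>n. a (Suc n) *
           (\<Sum>d | d dvd Suc n. principal_dchar p d / of_nat d powi (2 * k + 1)) *
           of_real (exp (- 2 * of_nat (Suc n) * \<beta>)))) =
     of_real (\<Sum>j = 1..nat k. (- 1) ^ (j - 1) *
       (of_nat p ^ (2 * j) - 1) * (of_nat p ^ (2 * nat k + 2 - 2 * j) - 1) *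
       (bernoulli (2 * j) / fact (2 * j)) *
       (bernoulli (2 * nat k + 2 - 2 * j) / fact (2 * nat k + 2 - 2 * j)) *
       \<alpha> ^ (nat k + 1 - j) * \<beta> ^ j)"
proof -
  define S where "S = (\<lambda>\<alpha>. infsum (\<lambda>(d, l). lambert_term p (2 * k + 1) \<alpha> d l) UNIV)"
  have p: "p > 0" using assms(1) prime_gt_0_nat by blast
  have a: "a n = wt p n" if "n \<ge> 1" for n
  proof (cases "p dvd n")
    case True
    then show ?thesis using assms(6)[OF that] by (simp add: wt_def)
  next
    case False
    then have "gcd n p = 1"
      using prime_imp_coprime[OF assms(1) False] by (simp add: coprime_iff_gcd_eq_1 gcd.commute)
    then show ?thesis using assms(5)[OF that] False by (simp add: wt_def)
  qed
  have sums: "(\<Sum>n. a (Suc n) * (\<Sum>d | d dvd Suc n. principal_dchar p d / of_nat d powi (2 * k + 1)) *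
           of_real (exp (- 2 * of_nat (Suc n) * x))) = S x" if "x > 0" for x
    using lambert_divisor_sum[OF assms(1) that a, where e = "2 * k + 1"] unfolding S_def by (simp only: sums_iff)
  \<comment> \<open>\<open>k \<noteq> 0\<close> keeps the argument away from the pole at 1, where
    \<open>L_fun\<close> need not agree with the normalised continuation.\<close>
  have "2 * k + 1 \<noteq> 1" using assms(7) by simp
  then have "of_int (2 * k + 1) \<noteq> (1 :: complex)" by (metis of_int_eq_1_iff)
  then have L: "dirichlet_L (of_int (2 * k + 1)) (principal_dchar p) = L_fun p (of_int (2 * k + 1))"
    by (rule dirichlet_L_principal[OF assms(1)])
  note \<alpha>\<beta> = assms(4)
  have \<beta>\<alpha>: "\<beta> * \<alpha> = pi\<^sup>2 / (real p)\<^sup>2" using assms(4) by (simp only: mult.commute)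
  show ?thesis
  proof (cases "k > 0")
    case True
    define n where "n = nat k"
    have n: "k = int n" "n \<ge> 1" "nat k = n" using True by (simp_all add: n_def)
    have powi: "(4 * of_real \<alpha>) powi (- k) = (of_real (1 / (4 * \<alpha>) ^ n) :: complex)"
         "(- 4 * of_real \<beta>) powi (- k) = (of_real (1 / (- 4 * \<beta>) ^ n) :: complex)"
      unfolding n(1) by (simp_all add: power_int_minus inverse_eq_divide)
    show ?thesis
      unfolding sums[OF assms(2)] sums[OF assms(3)] L powi n(3) unfolding S_def unfolding n(1)
        lambert_eq_chi_lattice[OF assms(2,3) \<alpha>\<beta> p n(2)] lambert_eq_chi_lattice[OF assms(3,2) \<beta>\<alpha> p n(2)]
      by (rule chi_lattice_transformation[OF assms(2,3) \<alpha>\<beta> p n(2)])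
  next
    case False
    define m where "m = nat (- k)"
    \<comment> \<open>\<open>nat k = 0\<close> makes the finite sum on the right empty, and the
      prefactors become ordinary \<open>m\<close>-th powers.\<close>
    have m: "k = - int m" "m \<ge> 1" "nat k = 0" "2 * k + 1 = 1 - 2 * int m" "- k = int m"
      using False assms(7) by (simp_all add: m_def)
    show ?thesis
      unfolding sums[OF assms(2)] sums[OF assms(3)] L unfolding S_def m(3,4,5) power_int_of_nat
        lambert_transformation_negative[OF assms(2,3) \<alpha>\<beta> p m(2)] by simp
  qed
qed

end
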